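(* Let $H$ be a complex Hilbert space with $\dim H\ge 3$, and let $\mathcal A$ and $\mathcal B$ be subsets of $\mathcal B(H)$ each of which contains $\mathcal F_1(H)$. Let $|||\cdot|||$ be a unitarily invariant norm on $\mathcal B(H)$. Suppose a surjective map $\Phi:\mathcal A\to\mathcal B$ satisfies $$|||\Phi(A)^*\Phi(B)|||=|||A^*B|||\qquad\text{for all }A,B\in\mathcal A.$$ Then there exist a unitary operator $U$ and a partial isometry $V_A$ in $\mathcal B(H)$, where $V_A$ depends on $A$ and $V_A^*V_A$ is the right support projection of $A$, such that either $$\Phi(A)=UAV_A^*\quad\text{for every }A\in\mathcal A,$$ or $$\Phi(A)=U\,JAJ\,V_A^*\quad\text{for every }A\in\mathcal A.$$
   Context: $\mathcal B(H)$ is the algebra of all bounded linear operators on $H$, and $\mathcal F_1(H)$ is the set of all rank one operators in $\mathcal B(H)$. A norm $|||\cdot|||$ on $\mathcal B(H)$ is unitarily invariant if $|||UAV|||=|||A|||$ for all $A\in\mathcal B(H)$ and all unitary $U,V\in\mathcal B(H)$. An arbitrary orthogonal basis $\{e_i\}_{i\in\Gamma}$ of $H$ is fixed, and $J:H\to H$ is the conjugation $J\left(\sum_i\xi_ie_i\right)=\sum_i\overline{\xi_i}e_i$; thus $JAJ$ is a bounded linear operator for $A\in\mathcal B(H)$. The right support projection of $A$ is the orthogonal projection onto $(\ker A)^\perp=\overline{\operatorname{ran}A^*}$.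
   Formalization: In the second alternative, V_A^*V_A is taken to be the right support projection of JAJ instead of that of A; with the right support of A the claim fails, e.g. for Φ(A)=JAJ on the rank one operators. *)

theory Defs
  imports "HOL-Analysis.Analysis"
begin

text \<open>
  Complex Hilbert spaces as a type class.  The inner product is linear in its first argument.
  Positive definiteness is contained in \<open>cinner_self\<close>, since \<open>norm\<close> is a norm.
\<close>

class chilbert_space = banach +
  fixes scaleC :: "complex \<Rightarrow> 'a \<Rightarrow> 'a"  (infixr "*\<^sub>C" 75)
    and cinner :: "'a \<Rightarrow> 'a \<Rightarrow> complex"
  assumes scaleC_add_right: "c *\<^sub>C (x + y) = c *\<^sub>C x + c *\<^sub>C y"
    and scaleC_add_left: "(c + d) *\<^sub>C x = c *\<^sub>C x + d *\<^sub>C x"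
    and scaleC_scaleC: "c *\<^sub>C (d *\<^sub>C x) = (c * d) *\<^sub>C x"
    and scaleR_scaleC: "r *\<^sub>R x = complex_of_real r *\<^sub>C x"
    and cinner_commute: "cinner x y = cnj (cinner y x)"
    and cinner_add_left: "cinner (x + y) z = cinner x z + cinner y z"
    and cinner_scaleC_left: "cinner (c *\<^sub>C x) y = c * cinner x y"
    and cinner_self: "cinner x x = complex_of_real ((norm x)\<^sup>2)"

interpretation complex_vector:
  vector_space "scaleC :: complex \<Rightarrow> 'a::chilbert_space \<Rightarrow> 'a"
proof
  fix x :: 'a
  show "1 *\<^sub>C x = x"
    using scaleR_scaleC[of 1 x] by simp
qed (simp_all add: scaleC_add_right scaleC_add_left scaleC_scaleC)

definition orthogonal_basis :: "'a::chilbert_space set \<Rightarrow> bool" where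
  "orthogonal_basis E \<longleftrightarrow>
     0 \<notin> E \<and>
     (\<forall>e\<in>E. \<forall>f\<in>E. e \<noteq> f \<longrightarrow> cinner e f = 0) \<and>
     (\<forall>x. \<exists>\<xi>. ((\<lambda>e. \<xi> e *\<^sub>C e) has_sum x) E)"

text \<open>
  The Hilbert space dimension is the common cardinality of all orthogonal bases.  Infinite bases
  are listed separately because \<^const>\<open>card\<close> is 0 on infinite sets.
\<close>

definition hilbert_dim_ge :: "'a::chilbert_space itself \<Rightarrow> nat \<Rightarrow> bool" where
  "hilbert_dim_ge _ n \<longleftrightarrow>
     (\<exists>E :: 'a set. orthogonal_basis E \<and> (infinite E \<or> n \<le> card E))"

text \<open>
  The coefficients of \<open>x\<close> with respect to an orthogonal basis are unique and square summable
  against the norms of the basis vectors, so the description below determines \<open>y\<close>.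
\<close>

definition conjugation :: "'a::chilbert_space set \<Rightarrow> 'a \<Rightarrow> 'a" where
  "conjugation E x =
     (THE y. \<exists>\<xi>. ((\<lambda>e. \<xi> e *\<^sub>C e) has_sum x) E \<and> ((\<lambda>e. cnj (\<xi> e) *\<^sub>C e) has_sum y) E)"

definition bounded_ops :: "('a::chilbert_space \<Rightarrow> 'a) set" where
  "bounded_ops = {A. bounded_linear A \<and> (\<forall>c x. A (c *\<^sub>C x) = c *\<^sub>C A x)}"

definition cadjoint :: "('a::chilbert_space \<Rightarrow> 'a) \<Rightarrow> 'a \<Rightarrow> 'a" where
  "cadjoint A = (THE B. \<forall>x y. cinner (A x) y = cinner x (B y))"

definition rank_one_ops :: "('a::chilbert_space \<Rightarrow> 'a) set" where
  "rank_one_ops = {A \<in> bounded_ops. complex_vector.dim (range A) = 1}"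

definition unitary :: "('a::chilbert_space \<Rightarrow> 'a) \<Rightarrow> bool" where
  "unitary U \<longleftrightarrow> U \<in> bounded_ops \<and> cadjoint U \<circ> U = id \<and> U \<circ> cadjoint U = id"

definition orth_complement :: "'a::chilbert_space set \<Rightarrow> 'a set" where
  "orth_complement S = {x. \<forall>y\<in>S. cinner x y = 0}"

definition orth_projection :: "'a::chilbert_space set \<Rightarrow> 'a \<Rightarrow> 'a" where
  "orth_projection M x = (THE p. p \<in> M \<and> x - p \<in> orth_complement M)"

definition kernel :: "('a::chilbert_space \<Rightarrow> 'a) \<Rightarrow> 'a set" where
  "kernel A = {x. A x = 0}"

text \<open>
  In a factorization \<open>S = T V\<^sup>*\<close> the initial projection \<open>V\<^sup>* V\<close> is to be the right support
  projection of the factor \<open>T\<close>.  In a conjugate-linear form \<open>\<Phi> A = U (J A J) V\<^sub>A\<^sup>*\<close> that is the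
  right support of \<open>J A J\<close>, which is in general not the right support of \<open>A\<close>: if
  \<open>A x = \<langle>x, e\<rangle> a\<close> with \<open>\<langle>J e, e\<rangle> = 0\<close> and \<open>V\<^sub>A\<^sup>* V\<^sub>A\<close> is the projection onto the span of \<open>e\<close>,
  then \<open>J A J V\<^sub>A\<^sup>* = 0\<close>.
\<close>

definition right_support :: "('a::chilbert_space \<Rightarrow> 'a) \<Rightarrow> 'a \<Rightarrow> 'a" where
  "right_support A = orth_projection (orth_complement (kernel A))"

definition partial_isometry :: "('a::chilbert_space \<Rightarrow> 'a) \<Rightarrow> bool" where
  "partial_isometry V \<longleftrightarrow>
     V \<in> bounded_ops \<and> (\<forall>x\<in>orth_complement (kernel V). norm (V x) = norm x)"

definition unitarily_invariant_norm :: "(('a::chilbert_space \<Rightarrow> 'a) \<Rightarrow> real) \<Rightarrow> bool" where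
  "unitarily_invariant_norm N \<longleftrightarrow>
     (\<forall>A\<in>bounded_ops. 0 \<le> N A \<and> (N A = 0 \<longleftrightarrow> A = (\<lambda>x. 0))) \<and>
     (\<forall>A\<in>bounded_ops. \<forall>B\<in>bounded_ops. N (\<lambda>x. A x + B x) \<le> N A + N B) \<and>
     (\<forall>c. \<forall>A\<in>bounded_ops. N (\<lambda>x. c *\<^sub>C A x) = cmod c * N A) \<and>
     (\<forall>A\<in>bounded_ops. \<forall>U V. unitary U \<longrightarrow> unitary V \<longrightarrow> N (U \<circ> A \<circ> V) = N A)"

end

theory Submission
  imports Defs
begin

text \<open>
  Write \<open>x \<otimes> y\<close> for the operator \<open>z \<mapsto> \<langle>z, y\<rangle> x\<close>.  Unitary invariance forces
  \<open>N (x \<otimes> y) = c \<parallel>x\<parallel> \<parallel>y\<parallel>\<close> with a constant \<open>c > 0\<close> (\<open>unitarily_invariant_norm_rank_one\<close>), so on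
  operators of rank one the hypothesis on \<open>\<Phi>\<close> is a statement about inner products of vectors, and on
  all other operators it can be read off by testing against operators of rank one.

  The map \<open>\<Phi>\<close> preserves rank one in both directions.  Indeed \<open>N (A\<^sup>* B) = 0\<close> means that the ranges of
  \<open>A\<close> and \<open>B\<close> are orthogonal, and the operators of rank one are distinguished by this relation alone:
  they are the nonzero operators orthogonal to as much as possible (\<open>rank_one_iff_orth_ranges\<close>).  If
  \<open>\<Phi> (x \<otimes> x) = a \<otimes> b\<close>, let \<open>T x\<close> be \<open>a\<close> rescaled to the length of \<open>x\<close>.  Comparing the norms of
  \<open>(x \<otimes> x)\<^sup>* (y \<otimes> y)\<close> and of its image gives \<open>\<bar>\<langle>T x, T y\<rangle>\<bar> = \<bar>\<langle>x, y\<rangle>\<bar>\<close>, and comparing those of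
  \<open>A\<^sup>* (x \<otimes> x)\<close> and of its image gives \<open>\<parallel>\<Phi>(A)\<^sup>* T x\<parallel> = \<parallel>A\<^sup>* x\<parallel>\<close> for every \<open>A\<close> in the domain
  (\<open>induced_vector_map\<close>).

  By Wigner's theorem \<open>T\<close> agrees up to phases with a unitary operator \<open>U\<close> or with \<open>U J\<close>.  Phases do not
  affect norms, so \<open>\<parallel>\<Phi>(A)\<^sup>* U x\<parallel> = \<parallel>A\<^sup>* x\<parallel>\<close> for all \<open>x\<close>, or the same with \<open>J A J\<close> in place of \<open>A\<close>.  Then
  \<open>A\<^sup>* x \<mapsto> \<Phi>(A)\<^sup>* U x\<close> is an isometry of the range of \<open>A\<^sup>*\<close>.  Extended to the closure of that range,
  which is the right support of \<open>A\<close>, and by zero to the orthogonal complement, it is a partial isometry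
  \<open>V\<close> with \<open>V A\<^sup>* = \<Phi>(A)\<^sup>* U\<close>, and taking adjoints gives \<open>\<Phi>(A) = U A V\<^sup>*\<close>
  (\<open>partial_isometry_factorization\<close>).
\<close>

section \<open>Inner product algebra\<close>

lemma cinner_add_right: "cinner x (y + z) = cinner x y + cinner (x::'a::chilbert_space) z"
  by (metis cinner_add_left cinner_commute complex_cnj_add)

lemma cinner_scaleC_right: "cinner x (c *\<^sub>C y) = cnj c * cinner (x::'a::chilbert_space) y"
  by (metis cinner_commute cinner_scaleC_left complex_cnj_mult)

lemma cinner_zero [simp]: "cinner 0 (x::'a::chilbert_space) = 0" "cinner (x::'a) 0 = 0"
  using cinner_scaleC_left[of 0 x x] cinner_scaleC_right[of x 0 x] by simp_all

lemma cinner_minus [simp]: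
  "cinner (- x) (y::'a::chilbert_space) = - cinner x y" "cinner (x::'a) (- y) = - cinner x y"
  using cinner_scaleC_left[of "-1" x y] cinner_scaleC_right[of x "-1" y] by simp_all

lemma cinner_diff:
  "cinner (x - y) (z::'a::chilbert_space) = cinner x z - cinner y z"
  "cinner (z::'a) (x - y) = cinner z x - cinner z y"
  using cinner_add_left[of x "- y" z] cinner_add_right[of z x "- y"] by simp_all

lemmas cinner_simps = cinner_add_left cinner_add_right cinner_scaleC_left cinner_scaleC_right
  cinner_diff

lemma cinner_self_eq_0 [simp]: "cinner x x = 0 \<longleftrightarrow> (x::'a::chilbert_space) = 0"
  by (simp add: cinner_self)

lemma Re_cinner_self: "Re (cinner x x) = (norm (x::'a::chilbert_space))\<^sup>2"
  by (simp add: cinner_self)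

lemma Re_cinner_commute: "Re (cinner x y) = Re (cinner (y::'a::chilbert_space) x)"
  by (metis cinner_commute complex_cnj(1) complex.collapse complex.sel(1))

lemma cmod_cinner_commute: "cmod (cinner x y) = cmod (cinner (y::'a::chilbert_space) x)"
  by (metis cinner_commute complex_mod_cnj)

lemma cinner_eq_0_commute: "cinner x y = 0 \<longleftrightarrow> cinner (y::'a::chilbert_space) x = 0"
  by (metis cinner_commute complex_cnj_zero)

lemma norm_scaleC [simp]: "norm (c *\<^sub>C x) = cmod c * norm (x::'a::chilbert_space)"
proof -
  have "(norm (c *\<^sub>C x))\<^sup>2 = Re ((c * cnj c) * cinner x x)"
    by (simp add: Re_cinner_self[symmetric] cinner_simps ac_simps)
  also have "\<dots> = (cmod c * norm x)\<^sup>2"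
    by (simp add: complex_norm_square[symmetric] cinner_self power_mult_distrib del: of_real_power)
  finally show ?thesis by (simp add: power2_eq_iff_nonneg)
qed

lemma norm_add_sq:
  "(norm (x + y))\<^sup>2 = (norm x)\<^sup>2 + (norm y)\<^sup>2 + 2 * Re (cinner x (y::'a::chilbert_space))"
  by (simp add: Re_cinner_self[symmetric] cinner_simps Re_cinner_commute[of y x])

lemma norm_diff_sq:
  "(norm (x - y))\<^sup>2 = (norm x)\<^sup>2 + (norm y)\<^sup>2 - 2 * Re (cinner x (y::'a::chilbert_space))"
  using norm_add_sq[of x "- y"] by simp

lemma cinner_eqI: "(\<And>z. cinner z x = cinner z y) \<Longrightarrow> x = (y::'a::chilbert_space)"
  by (metis cinner_diff(2) cinner_self_eq_0 eq_iff_diff_eq_0)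

text \<open>
  The squared distance of \<open>x\<close> from its component along \<open>y\<close>.  Nonnegativity of this number is the
  Cauchy--Schwarz inequality, and its vanishing is the case of equality.
\<close>

lemma norm_minus_component_sq:
  assumes "(y::'a::chilbert_space) \<noteq> 0"
  shows "(norm (x - (cinner x y / (norm y)\<^sup>2) *\<^sub>C y))\<^sup>2 = (norm x)\<^sup>2 - (cmod (cinner x y))\<^sup>2 / (norm y)\<^sup>2"
proof -
  have "Re (cinner x ((cinner x y / (norm y)\<^sup>2) *\<^sub>C y)) = (cmod (cinner x y))\<^sup>2 / (norm y)\<^sup>2"
    by (simp add: cinner_simps mult.commute[of "cnj _"] complex_norm_square[symmetric] del: of_real_power)
  moreover have "norm ((cinner x y / (norm y)\<^sup>2) *\<^sub>C y) = cmod (cinner x y) / norm y"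
    using assms by (simp add: norm_divide norm_mult power2_eq_square)
  ultimately show ?thesis by (simp add: norm_diff_sq power_divide)
qed

lemma cmod_cinner_le: "cmod (cinner x y) \<le> norm x * norm (y::'a::chilbert_space)"
proof (cases "y = 0")
  case False
  have "(cmod (cinner x y))\<^sup>2 / (norm y)\<^sup>2 \<le> (norm x)\<^sup>2"
    using norm_minus_component_sq[OF False, of x] by (metis diff_ge_0_iff_ge zero_le_power2)
  then have "(cmod (cinner x y))\<^sup>2 \<le> (norm x * norm y)\<^sup>2"
    using False by (simp add: field_simps power_mult_distrib)
  then show ?thesis by (simp add: power2_le_iff_abs_le)
qed simp

lemma eq_component_if_cmod_cinner_eq:
  assumes "cmod (cinner x y) = norm x * norm (y::'a::chilbert_space)" "y \<noteq> 0"
  shows "x = (cinner x y / (norm y)\<^sup>2) *\<^sub>C y"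
  using norm_minus_component_sq[OF assms(2), of x] assms
  by (simp add: power_mult_distrib)

text \<open>Equality in the Cauchy--Schwarz inequality for vectors of equal length.\<close>

lemma phase_if_cmod_cinner_eq:
  assumes "norm x = norm (y::'a::chilbert_space)" "cmod (cinner x y) = (norm x)\<^sup>2"
  shows "\<exists>c. cmod c = 1 \<and> x = c *\<^sub>C y"
proof (cases "y = 0")
  case True
  then show ?thesis using assms(1) by (intro exI[of _ 1]) simp
next
  case False
  have "x = (cinner x y / (norm y)\<^sup>2) *\<^sub>C y"
    using assms False by (intro eq_component_if_cmod_cinner_eq) (simp_all add: power2_eq_square)
  moreover have "cmod (cinner x y / (norm y)\<^sup>2) = 1"
    using assms False by (simp add: norm_divide norm_power)
  ultimately show ?thesis by blast
qed

lemma scaleC_scaleR: "c *\<^sub>C (r *\<^sub>R x) = r *\<^sub>R (c *\<^sub>C (x::'a::chilbert_space))"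
  by (simp add: scaleR_scaleC scaleC_scaleC mult.commute)

lemma bounded_linear_scaleC: "bounded_linear (\<lambda>x::'a::chilbert_space. c *\<^sub>C x)"
  by (intro bounded_linear_intro[of _ "cmod c"]) (simp_all add: scaleC_add_right scaleC_scaleR mult.commute)

lemma bounded_linear_cinner_left: "bounded_linear (\<lambda>x::'a::chilbert_space. cinner x y)"
  by (intro bounded_linear_intro[of _ "norm y"])
    (simp_all add: cinner_simps scaleR_scaleC scaleR_conv_of_real cmod_cinner_le)

section \<open>The projection theorem and the Riesz representation\<close>

lemma subspace_orth_complement: "complex_vector.subspace (orth_complement (S::'a::chilbert_space set))"
  unfolding complex_vector.subspace_def orth_complement_def by (simp add: cinner_simps)

lemma closed_orth_complement: "closed (orth_complement (S::'a::chilbert_space set))"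
proof -
  have "orth_complement S = (\<Inter>y\<in>S. (\<lambda>x. cinner x y) -` {0})"
    by (auto simp: orth_complement_def)
  moreover have "closed ((\<lambda>x. cinner x y) -` {0})" for y :: 'a
    by (intro closed_vimage) (simp_all add: linear_continuous_on bounded_linear_cinner_left)
  ultimately show ?thesis by auto
qed

text \<open>
  By the parallelogram law a sequence of points of \<open>M\<close> whose distances from \<open>x\<close> tend to the distance
  of \<open>M\<close> from \<open>x\<close> is Cauchy; its limit is a nearest point, hence the foot of the perpendicular.
\<close>

theorem projection_exists:
  assumes sub: "complex_vector.subspace (M::'a::chilbert_space set)" and cl: "closed M"
  shows "\<exists>p\<in>M. x - p \<in> orth_complement M"
proof -
  define d where "d = infdist x M"
  have M0: "0 \<in> M" using sub by (rule complex_vector.subspace_0)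
  have d_le: "d \<le> norm (x - m)" if "m \<in> M" for m
    using infdist_le[OF that] by (simp add: d_def dist_norm)
  have d0: "0 \<le> d" by (simp add: d_def infdist_nonneg)
  have "\<exists>m\<in>M. (norm (x - m))\<^sup>2 < d\<^sup>2 + inverse (Suc n)" for n
  proof -
    have "sqrt (d\<^sup>2 + inverse (Suc n)) > d"
      using d0 by (intro real_less_rsqrt) simp
    moreover have "M \<noteq> {}" using M0 by blast
    ultimately have "\<exists>r\<in>dist x ` M. r < sqrt (d\<^sup>2 + inverse (Suc n))"
      using cInf_lessD[of "dist x ` M"] by (simp add: d_def infdist_def)
    then obtain m where "m \<in> M" "norm (x - m) < sqrt (d\<^sup>2 + inverse (Suc n))"
      by (auto simp: dist_norm)
    then show ?thesis
      by (metis norm_ge_zero real_sqrt_abs real_sqrt_less_iff abs_norm_cancel)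
  qed
  then obtain y where y: "\<And>n. y n \<in> M" "\<And>n. (norm (x - y n))\<^sup>2 < d\<^sup>2 + inverse (Suc n)"
    by metis
  have par: "(norm (y m - y n))\<^sup>2 \<le> 2 * inverse (Suc m) + 2 * inverse (Suc n)" for m n
  proof -
    have "(1/2) *\<^sub>C (y m + y n) \<in> M"
      using sub y(1) by (intro complex_vector.subspace_scale complex_vector.subspace_add)
    then have "d \<le> norm (x - (1/2) *\<^sub>C (y m + y n))" by (rule d_le)
    then have "4 * d\<^sup>2 \<le> (2 * norm (x - (1/2) *\<^sub>C (y m + y n)))\<^sup>2"
      using d0 by (simp add: power_mono power_mult_distrib)
    also have "2 * norm (x - (1/2) *\<^sub>C (y m + y n)) = norm (2 *\<^sub>C (x - (1/2) *\<^sub>C (y m + y n)))"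
      by simp
    also have "2 *\<^sub>C (x - (1/2) *\<^sub>C (y m + y n)) = (x - y m) + (x - y n)"
      by (simp add: complex_vector.scale_right_diff_distrib scaleC_scaleC)
        (metis complex_vector.scale_left_distrib complex_vector.scale_one one_add_one)
    finally have "4 * d\<^sup>2 \<le> (norm ((x - y m) + (x - y n)))\<^sup>2" .
    moreover have "(norm (y m - y n))\<^sup>2 = (norm ((x - y m) - (x - y n)))\<^sup>2"
      by (simp add: norm_minus_commute)
    ultimately show ?thesis
      using y(2)[of m] y(2)[of n] norm_add_sq[of "x - y m" "x - y n"] norm_diff_sq[of "x - y m" "x - y n"]
      by linarith
  qed
  have "Cauchy y"
  proof (rule metric_CauchyI)
    fix e :: real assume "0 < e"
    then obtain k where k: "inverse (Suc k) < e\<^sup>2 / 4"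
      using reals_Archimedean[of "e\<^sup>2 / 4"] by auto
    have "dist (y m) (y n) < e" if "k \<le> m" "k \<le> n" for m n
    proof -
      have "inverse (real (Suc m)) \<le> inverse (Suc k)" "inverse (real (Suc n)) \<le> inverse (Suc k)"
        using that by (simp_all add: le_imp_inverse_le)
      then have "(norm (y m - y n))\<^sup>2 < e\<^sup>2"
        using par[of m n] k by linarith
      then show ?thesis using \<open>0 < e\<close> by (simp add: dist_norm power2_less_imp_less)
    qed
    then show "\<exists>k. \<forall>m\<ge>k. \<forall>n\<ge>k. dist (y m) (y n) < e" by blast
  qed
  then obtain p where p: "y \<longlonglongrightarrow> p" by (auto simp: Cauchy_convergent_iff convergent_def)
  have pM: "p \<in> M" using closed_sequentially[OF cl y(1) p] .
  have "(\<lambda>n. (norm (x - y n))\<^sup>2) \<longlonglongrightarrow> (norm (x - p))\<^sup>2"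
    by (intro tendsto_intros p)
  then have "(norm (x - p))\<^sup>2 \<le> d\<^sup>2 + 0"
  proof (rule LIMSEQ_le)
    show "(\<lambda>n. d\<^sup>2 + inverse (Suc n)) \<longlonglongrightarrow> d\<^sup>2 + 0"
      by (intro tendsto_intros LIMSEQ_inverse_real_of_nat)
    show "\<exists>N. \<forall>n\<ge>N. (norm (x - y n))\<^sup>2 \<le> d\<^sup>2 + inverse (Suc n)"
      using y(2) less_imp_le by blast
  qed
  then have min: "(norm (x - p))\<^sup>2 \<le> d\<^sup>2" by simp
  have "cinner (x - p) m = 0" if m: "m \<in> M" for m
  proof (cases "m = 0")
    case False
    have "p + (cinner (x - p) m / (norm m)\<^sup>2) *\<^sub>C m \<in> M"
      using sub pM m by (simp add: complex_vector.subspace_add complex_vector.subspace_scale)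
    from d_le[OF this] have "d\<^sup>2 \<le> (norm (x - p - (cinner (x - p) m / (norm m)\<^sup>2) *\<^sub>C m))\<^sup>2"
      using d0 by (simp add: diff_diff_eq power_mono)
    with min have "(cmod (cinner (x - p) m))\<^sup>2 / (norm m)\<^sup>2 \<le> 0"
      using norm_minus_component_sq[OF False, of "x - p"] by simp
    then show ?thesis using False by (simp add: field_simps divide_le_0_iff)
  qed simp
  then show ?thesis using pM by (auto simp: orth_complement_def)
qed

lemma orth_projection_unique:
  assumes "complex_vector.subspace (M::'a::chilbert_space set)"
    "p \<in> M" "x - p \<in> orth_complement M" "q \<in> M" "x - q \<in> orth_complement M"
  shows "p = q"
proof -
  have "p - q \<in> M" using assms complex_vector.subspace_diff by blast
  moreover have "(x - q) - (x - p) \<in> orth_complement M"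
    using assms subspace_orth_complement complex_vector.subspace_diff by blast
  ultimately have "cinner (p - q) (p - q) = 0" by (simp add: orth_complement_def)
  then show ?thesis by simp
qed

lemma orth_projection:
  assumes "complex_vector.subspace (M::'a::chilbert_space set)" "closed M"
  shows "orth_projection M x \<in> M" "x - orth_projection M x \<in> orth_complement M"
proof -
  have "\<exists>!p. p \<in> M \<and> x - p \<in> orth_complement M"
    using projection_exists[OF assms] orth_projection_unique[OF assms(1)] by blast
  from theI'[OF this] show "orth_projection M x \<in> M" "x - orth_projection M x \<in> orth_complement M"
    unfolding orth_projection_def by blast+
qed

lemma orth_projection_eqI:
  assumes "complex_vector.subspace (M::'a::chilbert_space set)" "p \<in> M" "x - p \<in> orth_complement M"
  shows "orth_projection M x = p"
  unfolding orth_projection_def using orth_projection_unique[OF assms(1)] assms by blast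

text \<open>
  The vector representing \<open>f\<close> is a multiple of any nonzero vector orthogonal to the kernel of \<open>f\<close>.
\<close>

theorem Riesz_representation:
  fixes f :: "'a::chilbert_space \<Rightarrow> complex"
  assumes "bounded_linear f" and scale: "\<And>c x. f (c *\<^sub>C x) = c * f x"
  shows "\<exists>y. \<forall>x. f x = cinner x y"
proof (cases "\<forall>x. f x = 0")
  case True
  then show ?thesis by (intro exI[of _ 0]) simp
next
  case False
  interpret f: bounded_linear f by fact
  obtain u where u: "f u \<noteq> 0" using False by blast
  let ?K = "f -` {0}"
  have "complex_vector.subspace ?K"
    by (simp add: complex_vector.subspace_def f.zero f.add scale)
  moreover have "closed ?K"
    by (intro closed_vimage) (simp_all add: linear_continuous_on assms(1))
  ultimately obtain p where p: "f p = 0" "u - p \<in> orth_complement ?K"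
    using projection_exists[of ?K u] by auto
  define w where "w = u - p"
  have fw: "f w \<noteq> 0" using u p by (simp add: w_def f.diff)
  then have w0: "cinner w w \<noteq> 0" using f.zero by auto
  have "f x = cinner x ((cnj (f w) / cinner w w) *\<^sub>C w)" for x
  proof -
    have "x - (f x / f w) *\<^sub>C w \<in> ?K" using fw by (simp add: f.diff scale)
    then have "cinner w (x - (f x / f w) *\<^sub>C w) = 0"
      using p(2) by (auto simp: w_def[symmetric] orth_complement_def)
    then have "cinner (x - (f x / f w) *\<^sub>C w) w = 0" by (simp only: cinner_eq_0_commute)
    then have "cinner x w = f x / f w * cinner w w" by (simp add: cinner_simps)
    moreover have "cnj (cinner w w) = cinner w w" using cinner_commute[of w w] by simp
    ultimately show ?thesis using fw w0 by (simp add: cinner_simps)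
  qed
  then show ?thesis by blast
qed

section \<open>Adjoints, unitary operators and rank one operators\<close>

lemma bounded_opsI:
  assumes "\<And>x y. A (x + y) = A x + A (y::'a::chilbert_space)"
    and "\<And>c x. A (c *\<^sub>C x) = c *\<^sub>C A (x::'a)" and "\<And>x. norm (A x) \<le> norm x * K"
  shows "A \<in> bounded_ops"
  unfolding bounded_ops_def using assms
  by (auto intro!: bounded_linear_intro[of A K] simp: scaleR_scaleC)

lemma bounded_opsD:
  assumes "A \<in> bounded_ops"
  shows "bounded_linear A" "A (x + y) = A x + A (y::'a::chilbert_space)"
    "A (x - y) = A x - A (y::'a)" "A 0 = 0" "A (c *\<^sub>C x) = c *\<^sub>C A x"
  using assms by (simp_all add: bounded_ops_def linear_simps)

lemma cadjoint_eqI: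
  assumes "\<And>x y. cinner (A x) y = cinner x (B (y::'a::chilbert_space))"
  shows "cadjoint A = B"
  unfolding cadjoint_def
proof (rule the_equality)
  show "C = B" if "\<forall>x y. cinner (A x) y = cinner x (C y)" for C
    using that assms by (intro ext cinner_eqI) simp
qed (use assms in blast)

lemma cinner_cadjoint_right:
  assumes "A \<in> bounded_ops"
  shows "cinner x (cadjoint A y) = cinner (A x) (y::'a::chilbert_space)"
proof -
  have "\<exists>z. \<forall>x. cinner (A x) y = cinner x z" for y
    by (rule Riesz_representation)
      (use assms in \<open>simp_all add: bounded_opsD cinner_simps
        bounded_linear_compose[OF bounded_linear_cinner_left]\<close>)
  then obtain B where "\<And>x y. cinner (A x) y = cinner x (B y)" by metis
  with cadjoint_eqI[of A B] show ?thesis by simp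
qed

lemma cinner_cadjoint_left:
  "A \<in> bounded_ops \<Longrightarrow> cinner (cadjoint A x) y = cinner x (A (y::'a::chilbert_space))"
  by (metis cinner_cadjoint_right cinner_commute)

lemma cadjoint_in_bounded_ops:
  assumes A: "A \<in> bounded_ops"
  shows "cadjoint (A :: 'a::chilbert_space \<Rightarrow> 'a) \<in> bounded_ops"
proof -
  obtain K where K: "\<And>x. norm (A x) \<le> norm x * K" "0 \<le> K"
    using bounded_linear.nonneg_bounded[OF bounded_opsD(1)[OF A]] by blast
  have "norm (cadjoint A y) \<le> norm y * K" for y
  proof (cases "cadjoint A y = 0")
    case False
    have "(norm (cadjoint A y))\<^sup>2 = cmod (cinner (A (cadjoint A y)) y)"
      by (simp add: cinner_cadjoint_right[OF A, symmetric] cinner_self norm_power)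
    also have "\<dots> \<le> norm (cadjoint A y) * K * norm y"
      using cmod_cinner_le K(1) by (meson mult_right_mono norm_ge_zero order_trans)
    finally show ?thesis using False by (simp add: power2_eq_square mult.assoc mult.commute[of K])
  qed (use K in simp)
  then show ?thesis
    by (intro bounded_opsI cinner_eqI) (simp_all add: cinner_simps cinner_cadjoint_right[OF A])
qed

lemma bounded_ops_comp:
  assumes "A \<in> bounded_ops" "B \<in> bounded_ops"
  shows "A \<circ> (B :: 'a::chilbert_space \<Rightarrow> 'a) \<in> bounded_ops"
  using assms by (auto simp: bounded_ops_def intro: bounded_linear_compose[unfolded comp_def[symmetric]])

text \<open>
  Polarization.  The real part of the inner product is determined by the norm, and for maps commuting
  with multiplication by \<open>\<i>\<close> so is the imaginary part.
\<close>

lemma Re_cinner_eq_if_norm_eq: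
  fixes S T :: "'b::plus \<Rightarrow> 'a::chilbert_space"
  assumes "\<And>x y. S (x + y) = S x + S y" "\<And>x y. T (x + y) = T x + T y" "\<And>x. norm (S x) = norm (T x)"
  shows "Re (cinner (S x) (S y)) = Re (cinner (T x) (T y))"
  using norm_add_sq[of "S x" "S y"] norm_add_sq[of "T x" "T y"] by (simp add: assms(1,2)[symmetric] assms(3))

lemma cinner_eq_if_norm_eq:
  fixes S T :: "'a::chilbert_space \<Rightarrow> 'a"
  assumes "S \<in> bounded_ops" "T \<in> bounded_ops" "\<And>x. norm (S x) = norm (T x)"
  shows "cinner (S x) (S y) = cinner (T x) (T y)"
proof -
  have Re: "Re (cinner (S x) (S y)) = Re (cinner (T x) (T y))" for x y
    using assms by (intro Re_cinner_eq_if_norm_eq) (simp_all add: bounded_opsD)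
  show ?thesis
    using Re[of x y] Re[of x "\<i> *\<^sub>C y"] assms(1,2)
    by (intro complex_eqI) (simp_all add: bounded_opsD cinner_simps)
qed

lemma id_in_bounded_ops: "(\<lambda>x::'a::chilbert_space. x) \<in> bounded_ops"
  by (simp add: bounded_ops_def)

lemma unitaryI:
  assumes U: "U \<in> bounded_ops" and iso: "\<And>x. norm (U x) = norm (x::'a::chilbert_space)" and "surj U"
  shows "unitary U"
proof -
  have in_eq: "cinner (U x) (U y) = cinner x y" for x y
    by (rule cinner_eq_if_norm_eq[OF U id_in_bounded_ops iso])
  have left: "cadjoint U (U x) = x" for x
    by (rule cinner_eqI) (simp add: cinner_cadjoint_right[OF U] in_eq)
  have "U (cadjoint U y) = y" for y
    using \<open>surj U\<close> left by (metis surj_def)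
  with left U show ?thesis by (auto simp: unitary_def)
qed

lemma unitaryD:
  assumes "unitary (U :: 'a::chilbert_space \<Rightarrow> 'a)"
  shows "U \<in> bounded_ops" "cadjoint U (U x) = x" "U (cadjoint U x) = x"
    "cinner (U x) (U y) = cinner x y" "norm (U x) = norm x"
proof -
  show U: "U \<in> bounded_ops" and 1: "cadjoint U (U x) = x" and "U (cadjoint U x) = x" for x
    using assms by (auto simp: unitary_def fun_eq_iff)
  show in_eq: "cinner (U x) (U y) = cinner x y" for x y
    using cinner_cadjoint_right[OF U, of x "U y"] 1 by simp
  show "norm (U x) = norm x"
    using Re_cinner_self[of "U x"] Re_cinner_self[of x] by (simp add: in_eq power2_eq_iff_nonneg)
qed

text \<open>
  After multiplying \<open>v\<close> by a phase the inner product of \<open>u\<close> and \<open>v\<close> is real, and then the reflection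
  in the hyperplane orthogonal to \<open>u - v\<close> exchanges the two vectors.
\<close>

lemma unitary_transitive:
  assumes norm_eq: "norm u = norm (v::'a::chilbert_space)"
  shows "\<exists>U. unitary U \<and> U u = v"
proof -
  have scalar: "unitary (\<lambda>x::'a. c *\<^sub>C x)" if "cmod c = 1" for c
  proof (rule unitaryI)
    show "(\<lambda>x::'a. c *\<^sub>C x) \<in> bounded_ops"
      using that by (intro bounded_opsI[of _ 1]) (simp_all add: scaleC_add_right scaleC_scaleC mult.commute)
    have "c \<noteq> 0" using that by auto
    then show "surj (\<lambda>x::'a. c *\<^sub>C x)"
      by (intro surjI[of _ "\<lambda>x. inverse c *\<^sub>C x"]) (simp add: scaleC_scaleC)
  qed (use that in simp)
  define c where "c = (if cinner u v = 0 then 1 else cinner u v / cmod (cinner u v))"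
  have c1: "cmod c = 1" by (simp add: c_def norm_divide)
  define w where "w = c *\<^sub>C v"
  have norm_w: "norm w = norm u" using c1 norm_eq by (simp add: w_def)
  have real: "cinner u w = complex_of_real (cmod (cinner u v))"
    by (auto simp: w_def c_def cinner_simps complex_norm_square[symmetric] power2_eq_square
      mult.commute[of "cnj _"] simp del: of_real_power)
  have real': "cinner w u = cinner u w" using cinner_commute[of w u] real by simp
  have "\<exists>R. unitary R \<and> R u = w"
  proof (cases "u = w")
    case True
    then show ?thesis using scalar[of 1] by (intro exI[of _ "\<lambda>x. 1 *\<^sub>C x"]) simp
  next
    case False
    define d where "d = u - w"
    have d0: "norm d \<noteq> 0" using False by (simp add: d_def)
    define k where "k = complex_of_real (2 / (norm d)\<^sup>2)"
    have dd: "k * cinner d d = 2" using d0 by (simp add: k_def cinner_self)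
    have [simp]: "cnj k = k" by (simp add: k_def)
    define R where "R = (\<lambda>x. x - (k * cinner x d) *\<^sub>C d)"
    have Rd: "cinner (R x) d = - cinner x d" for x
      using dd by (simp add: R_def cinner_simps algebra_simps)
    have invol: "R (R x) = x" for x
      by (simp add: R_def[THEN fun_cong, of "R x"] Rd) (simp add: R_def)
    have in_eq: "cinner (R x) y = cinner x (R y)" for x y
      using cinner_commute[of d y] by (simp add: R_def cinner_simps)
    have iso: "norm (R x) = norm x" for x
      using Re_cinner_self[of "R x"] Re_cinner_self[of x]
      by (simp add: in_eq invol power2_eq_iff_nonneg)
    have "unitary R"
    proof (rule unitaryI)
      show "R \<in> bounded_ops"
      proof (rule bounded_opsI[of _ 1])
        show "R (x + y) = R x + R y" for x y
          by (simp add: R_def cinner_simps distrib_left scaleC_add_left)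
        show "R (a *\<^sub>C x) = a *\<^sub>C R x" for a x
          by (simp add: R_def cinner_simps complex_vector.scale_right_diff_distrib scaleC_scaleC ac_simps)
      qed (simp add: iso)
      show "surj R" using invol by (metis surj_def)
    qed (fact iso)
    moreover have "R u = w"
    proof -
      have "cinner d d = 2 * cinner u d"
        using real' norm_w cinner_self[of w] cinner_self[of u] by (simp add: d_def cinner_simps)
      then have "k * cinner u d = 1" using dd by (simp add: mult.left_commute)
      then show ?thesis by (simp add: R_def d_def)
    qed
    ultimately show ?thesis by blast
  qed
  then obtain R where R: "unitary R" "R u = w" by blast
  have "unitary (\<lambda>x. cnj c *\<^sub>C R x)"
  proof (rule unitaryI)
    show "(\<lambda>x. cnj c *\<^sub>C R x) \<in> bounded_ops"
      using bounded_ops_comp[OF unitaryD(1)[OF scalar[of "cnj c"]] unitaryD(1)[OF R(1)]] c1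
      by (simp add: comp_def)
    show "norm (cnj c *\<^sub>C R x) = norm x" for x using c1 unitaryD(5)[OF R(1)] by simp
    show "surj (\<lambda>x. cnj c *\<^sub>C R x)"
      using c1 R(1) complex_norm_square[of c]
      by (intro surjI[of _ "\<lambda>x. cadjoint R (c *\<^sub>C x)"]) (simp add: unitaryD scaleC_scaleC mult.commute)
  qed
  moreover have "cnj c *\<^sub>C R u = v"
    using R(2) c1 complex_norm_square[of c] by (simp add: w_def scaleC_scaleC mult.commute)
  ultimately show ?thesis by blast
qed

definition rank_one :: "'a::chilbert_space \<Rightarrow> 'a \<Rightarrow> 'a \<Rightarrow> 'a" where
  "rank_one x y = (\<lambda>z. cinner z y *\<^sub>C x)"

lemma rank_one_in_bounded_ops: "rank_one x (y::'a::chilbert_space) \<in> bounded_ops"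
  by (rule bounded_opsI[of _ "norm y * norm x"])
    (simp_all add: rank_one_def cinner_simps scaleC_add_left scaleC_scaleC cmod_cinner_le mult_right_mono
      mult.assoc[symmetric])

lemma cadjoint_rank_one: "cadjoint (rank_one x y) = rank_one y (x::'a::chilbert_space)"
  by (rule cadjoint_eqI) (simp add: rank_one_def cinner_simps cinner_commute[symmetric])

lemma cadjoint_comp_rank_one:
  "A \<in> bounded_ops \<Longrightarrow> cadjoint A \<circ> rank_one x y = rank_one (cadjoint A x) (y::'a::chilbert_space)"
  by (simp add: rank_one_def comp_def bounded_opsD(5) cadjoint_in_bounded_ops)

lemma rank_one_if_values_in_line:
  assumes A: "A \<in> bounded_ops" and x: "(x::'a::chilbert_space) \<noteq> 0" and line: "\<And>z. \<exists>k. A z = k *\<^sub>C x"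
  shows "\<exists>y. A = rank_one x y"
proof -
  have "A z = rank_one x ((1 / complex_of_real ((norm x)\<^sup>2)) *\<^sub>C cadjoint A x) z" for z
  proof -
    obtain k where "A z = k *\<^sub>C x" using line by blast
    then show ?thesis
      using x by (simp add: rank_one_def cinner_simps cinner_cadjoint_right[OF A] cinner_self)
  qed
  then show ?thesis by blast
qed

lemma rank_one_ops_iff:
  "A \<in> rank_one_ops \<longleftrightarrow> (\<exists>x y. x \<noteq> 0 \<and> y \<noteq> 0 \<and> A = rank_one x (y::'a::chilbert_space))"
proof
  assume "A \<in> rank_one_ops"
  then have A: "A \<in> bounded_ops" and dim: "complex_vector.dim (range A) = 1"
    by (simp_all add: rank_one_ops_def)
  obtain B where B: "B \<subseteq> range A" "complex_vector.independent B" "range A \<subseteq> complex_vector.span B" "card B = 1"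
    using complex_vector.basis_exists[of "range A"] dim by metis
  then obtain x where x: "B = {x}" by (auto simp: card_1_singleton_iff)
  with B(2) have x0: "x \<noteq> 0" by (simp add: complex_vector.dependent_single)
  have "\<exists>k. A z = k *\<^sub>C x" for z
    using B(3) x by (auto simp: complex_vector.span_singleton)
  then obtain y where eq: "A = rank_one x y"
    using rank_one_if_values_in_line[OF A x0] by blast
  moreover have "y \<noteq> 0"
  proof
    assume "y = 0"
    then have "range A \<subseteq> {0}" by (auto simp: eq rank_one_def)
    then show False using B(1) x x0 by auto
  qed
  ultimately show "\<exists>x y. x \<noteq> 0 \<and> y \<noteq> 0 \<and> A = rank_one x y" using x0 by blast
next
  assume "\<exists>x y. x \<noteq> 0 \<and> y \<noteq> 0 \<and> A = rank_one x y"
  then obtain x y where x: "x \<noteq> 0" and y: "y \<noteq> 0" and A: "A = rank_one x y" by blast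
  have "k *\<^sub>C x = A ((k / cinner y y) *\<^sub>C y)" for k
    using y by (simp add: A rank_one_def cinner_simps)
  then have "range (\<lambda>k. k *\<^sub>C x) \<subseteq> range A" by blast
  moreover have "range A \<subseteq> range (\<lambda>k. k *\<^sub>C x)" by (auto simp: A rank_one_def)
  ultimately have "range A = complex_vector.span {x}"
    by (simp add: complex_vector.span_singleton)
  moreover have "complex_vector.dim (complex_vector.span {x}) = card {x}"
    using x by (intro complex_vector.dim_span_eq_card_independent) (simp add: complex_vector.dependent_single)
  ultimately show "A \<in> rank_one_ops" by (simp add: rank_one_ops_def A rank_one_in_bounded_ops)
qed

lemma unitarily_invariant_normD:
  assumes "unitarily_invariant_norm N" and "A \<in> bounded_ops"
  shows "0 \<le> N A" "N A = 0 \<longleftrightarrow> A = (\<lambda>x. 0)" "N (\<lambda>x. c *\<^sub>C A x) = cmod c * N A"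
    "unitary U \<Longrightarrow> unitary V \<Longrightarrow> N (U \<circ> A \<circ> V) = N (A :: 'a::chilbert_space \<Rightarrow> 'a)"
  using assms unfolding unitarily_invariant_norm_def by blast+

text \<open>
  Unitary operators act transitively on the unit sphere, so all rank one operators
  \<open>rank_one x y\<close> with unit vectors \<open>x\<close> and \<open>y\<close> have the same norm.
\<close>

lemma unitarily_invariant_norm_rank_one:
  fixes N :: "('a::chilbert_space \<Rightarrow> 'a) \<Rightarrow> real"
  assumes N: "unitarily_invariant_norm N"
  shows "\<exists>c>0. \<forall>x y. N (rank_one x y) = c * norm x * norm y"
proof (cases "\<forall>x::'a. x = 0")
  case True
  then have "rank_one x y = (\<lambda>z::'a. 0)" for x y by (intro ext) blast
  then have "N (rank_one x y) = 0" for x y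
    using unitarily_invariant_normD(2)[OF N rank_one_in_bounded_ops[of x y]] by simp
  then show ?thesis using True by (intro exI[of _ 1]) simp
next
  case False
  then obtain x0 :: 'a where "x0 \<noteq> 0" by blast
  define e where "e = inverse (norm x0) *\<^sub>R x0"
  have e: "norm e = 1" using \<open>x0 \<noteq> 0\<close> by (simp add: e_def)
  have pos: "0 < N (rank_one e e)"
  proof -
    have "rank_one e e e \<noteq> 0" using e by (auto simp: rank_one_def cinner_self)
    then have "rank_one e e \<noteq> (\<lambda>x. 0)" by auto
    then show ?thesis
      using unitarily_invariant_normD(1,2)[OF N rank_one_in_bounded_ops[of e e]] by simp
  qed
  have "N (rank_one x y) = N (rank_one e e) * norm x * norm y" for x y
  proof -
    obtain U where U: "unitary U" "U (complex_of_real (norm x) *\<^sub>C e) = x"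
      using unitary_transitive[of "complex_of_real (norm x) *\<^sub>C e" x] e by auto
    obtain V where V: "unitary V" "V y = complex_of_real (norm y) *\<^sub>C e"
      using unitary_transitive[of y "complex_of_real (norm y) *\<^sub>C e"] e by auto
    have "rank_one x y = U \<circ> (\<lambda>z. (norm x * norm y) *\<^sub>C rank_one e e z) \<circ> V"
    proof
      fix z
      have "cinner z y = norm y * cinner (V z) e"
        using unitaryD(4)[OF V(1), of z y] by (simp add: V(2) cinner_simps)
      moreover have "U ((complex_of_real (norm x) * k) *\<^sub>C e) = k *\<^sub>C x" for k
        using bounded_opsD(5)[OF unitaryD(1)[OF U(1)], of k "complex_of_real (norm x) *\<^sub>C e"] U(2)
        by (simp add: mult.commute)
      ultimately show "rank_one x y z = (U \<circ> (\<lambda>z. (norm x * norm y) *\<^sub>C rank_one e e z) \<circ> V) z"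
        by (simp add: rank_one_def scaleC_scaleC mult.assoc)
    qed
    moreover have "(\<lambda>z. complex_of_real (norm x * norm y) *\<^sub>C rank_one e e z) \<in> bounded_ops"
      using bounded_linear_compose[OF bounded_linear_scaleC bounded_opsD(1)[OF rank_one_in_bounded_ops]]
      by (simp add: bounded_ops_def bounded_opsD(5)[OF rank_one_in_bounded_ops] scaleC_scaleC mult.commute)
    ultimately have "N (rank_one x y) = N (\<lambda>z. (norm x * norm y) *\<^sub>C rank_one e e z)"
      using unitarily_invariant_normD(4)[OF N _ U(1) V(1)] by simp
    also have "\<dots> = cmod (norm x * norm y) * N (rank_one e e)"
      by (rule unitarily_invariant_normD(3)[OF N rank_one_in_bounded_ops])
    finally show ?thesis by (simp add: norm_mult)
  qed
  then show ?thesis using pos by blast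
qed

section \<open>The conjugation of an orthogonal basis\<close>

lemma norm_sum_orthogonal:
  fixes E :: "'a::chilbert_space set"
  assumes "finite F" "\<And>e f. e \<in> F \<Longrightarrow> f \<in> F \<Longrightarrow> e \<noteq> f \<Longrightarrow> cinner e f = 0"
  shows "(norm (\<Sum>e\<in>F. \<xi> e *\<^sub>C e))\<^sup>2 = (\<Sum>e\<in>F. (cmod (\<xi> e) * norm (e::'a))\<^sup>2)"
  using assms
proof (induction F)
  case (insert a F)
  have "cinner (\<Sum>e\<in>F. \<xi> e *\<^sub>C e) a = (\<Sum>e\<in>F. cinner (\<xi> e *\<^sub>C e) a)"
    by (rule linear_sum[OF bounded_linear.linear[OF bounded_linear_cinner_left]])
  also have "\<dots> = 0"
    using insert by (intro sum.neutral) (auto simp: cinner_simps)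
  finally have "cinner (\<xi> a *\<^sub>C a) (\<Sum>e\<in>F. \<xi> e *\<^sub>C e) = 0"
    by (subst cinner_eq_0_commute) (simp add: cinner_simps)
  then show ?case using insert by (simp add: norm_add_sq)
qed simp

context
  fixes E :: "'a::chilbert_space set"
  assumes E: "orthogonal_basis E"
begin

lemma orthogonal_basisD:
  "e \<in> E \<Longrightarrow> e \<noteq> 0" "e \<in> E \<Longrightarrow> f \<in> E \<Longrightarrow> e \<noteq> f \<Longrightarrow> cinner e f = 0"
  "\<exists>\<xi>. ((\<lambda>e. \<xi> e *\<^sub>C e) has_sum x) E"
  using E unfolding orthogonal_basis_def by blast+

lemma orthogonal_basis_coefficient:
  assumes "((\<lambda>e. \<xi> e *\<^sub>C e) has_sum x) E" "f \<in> E"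
  shows "cinner x f = \<xi> f * complex_of_real ((norm f)\<^sup>2)"
proof -
  have "((\<lambda>e. cinner (\<xi> e *\<^sub>C e) f) has_sum cinner x f) E"
    by (rule has_sum_bounded_linear[OF bounded_linear_cinner_left assms(1)])
  moreover have "((\<lambda>e. cinner (\<xi> e *\<^sub>C e) f) has_sum \<xi> f * complex_of_real ((norm f)\<^sup>2)) E"
    using assms(2) by (intro has_sum_finite_neutralI[of "{f}"])
      (auto simp: orthogonal_basisD cinner_simps cinner_self)
  ultimately show ?thesis by (rule has_sum_unique)
qed

lemma orthogonal_basis_coefficient_unique:
  assumes "((\<lambda>e. \<xi> e *\<^sub>C e) has_sum x) E" "((\<lambda>e. \<eta> e *\<^sub>C e) has_sum x) E" "f \<in> E"
  shows "\<xi> f = \<eta> f"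
  using orthogonal_basis_coefficient[OF assms(1,3)] orthogonal_basis_coefficient[OF assms(2,3)]
    orthogonal_basisD(1)[OF assms(3)] by simp

text \<open>
  Conjugating the coefficients changes neither the norms of finite sums nor the distances between
  them, so the conjugated series satisfies the Cauchy criterion together with the given one.
\<close>

lemma dist_conjugated_sums:
  assumes "finite F" "finite G" "F \<subseteq> E" "G \<subseteq> E"
  shows "dist (\<Sum>e\<in>F. cnj (\<xi> e) *\<^sub>C e) (\<Sum>e\<in>G. cnj (\<xi> e) *\<^sub>C e)
    = dist (\<Sum>e\<in>F. \<xi> e *\<^sub>C e) (\<Sum>e\<in>G. \<xi> e *\<^sub>C e)"
proof -
  \<comment> \<open>The coefficients of the difference of the two sums, taken over the union of the index sets.\<close>
  define \<delta> :: "'a \<Rightarrow> complex" where "\<delta> e = of_bool (e \<in> F) - of_bool (e \<in> G)" for e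
  have diff: "(\<Sum>e\<in>F. \<eta> e *\<^sub>C e) - (\<Sum>e\<in>G. \<eta> e *\<^sub>C e) = (\<Sum>e\<in>F \<union> G. (\<delta> e * \<eta> e) *\<^sub>C e)" for \<eta>
  proof -
    have "(\<Sum>e\<in>F. \<eta> e *\<^sub>C e) = (\<Sum>e\<in>F \<union> G. (of_bool (e \<in> F) * \<eta> e) *\<^sub>C e)"
      using assms by (intro sum.mono_neutral_cong_left) auto
    moreover have "(\<Sum>e\<in>G. \<eta> e *\<^sub>C e) = (\<Sum>e\<in>F \<union> G. (of_bool (e \<in> G) * \<eta> e) *\<^sub>C e)"
      using assms by (intro sum.mono_neutral_cong_left) auto
    ultimately show ?thesis
      by (simp add: sum_subtractf[symmetric] complex_vector.scale_left_diff_distrib[symmetric] \<delta>_def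
        left_diff_distrib)
  qed
  have orth: "\<And>e f. e \<in> F \<union> G \<Longrightarrow> f \<in> F \<union> G \<Longrightarrow> e \<noteq> f \<Longrightarrow> cinner e f = 0"
    using orthogonal_basisD(2) assms by blast
  have fin: "finite (F \<union> G)" using assms by simp
  have sq: "(norm (\<Sum>e\<in>F \<union> G. (\<delta> e * \<eta> e) *\<^sub>C e))\<^sup>2 = (\<Sum>e\<in>F \<union> G. (cmod (\<delta> e * \<eta> e) * norm e)\<^sup>2)"
    for \<eta> by (rule norm_sum_orthogonal[OF fin orth])
  have "(norm ((\<Sum>e\<in>F. cnj (\<xi> e) *\<^sub>C e) - (\<Sum>e\<in>G. cnj (\<xi> e) *\<^sub>C e)))\<^sup>2
    = (norm ((\<Sum>e\<in>F. \<xi> e *\<^sub>C e) - (\<Sum>e\<in>G. \<xi> e *\<^sub>C e)))\<^sup>2"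
    unfolding diff sq by (simp add: norm_mult)
  then show ?thesis by (simp add: dist_norm power2_eq_iff_nonneg)
qed

lemma conjugated_sum_exists:
  assumes "((\<lambda>e. \<xi> e *\<^sub>C e) has_sum x) E"
  shows "\<exists>y. ((\<lambda>e. cnj (\<xi> e) *\<^sub>C e) has_sum y) E"
proof -
  let ?S = "\<lambda>F. \<Sum>e\<in>F. \<xi> e *\<^sub>C e" and ?S' = "\<lambda>F. \<Sum>e\<in>F. cnj (\<xi> e) *\<^sub>C e"
  have "\<exists>P. eventually P (finite_subsets_at_top E) \<and> (\<forall>F G. P F \<and> P G \<longrightarrow> dist (?S' F) (?S' G) < r)"
    if "r > 0" for r :: real
  proof (intro exI[of _ "\<lambda>F. dist (?S F) x < r / 2 \<and> finite F \<and> F \<subseteq> E"] conjI allI impI)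
    have "eventually (\<lambda>F. dist (?S F) x < r / 2) (finite_subsets_at_top E)"
      using assms \<open>r > 0\<close> unfolding has_sum_def by (intro tendstoD) auto
    then show "eventually (\<lambda>F. dist (?S F) x < r / 2 \<and> finite F \<and> F \<subseteq> E) (finite_subsets_at_top E)"
      by (rule eventually_conj) (auto intro!: eventually_finite_subsets_at_top_weakI)
    fix F G
    assume *: "(dist (?S F) x < r / 2 \<and> finite F \<and> F \<subseteq> E) \<and> (dist (?S G) x < r / 2 \<and> finite G \<and> G \<subseteq> E)"
    then have "dist (?S F) (?S G) < r" by (meson dist_triangle_half_l)
    with * show "dist (?S' F) (?S' G) < r" by (simp add: dist_conjugated_sums)
  qed
  then have "cauchy_filter (filtermap ?S' (finite_subsets_at_top E))"
    by (simp add: cauchy_filter_metric_filtermap)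
  moreover have "complete (UNIV :: 'a set)"
    by (meson Cauchy_convergent UNIV_I complete_def convergent_def)
  ultimately obtain y where "(?S' \<longlongrightarrow> y) (finite_subsets_at_top E)"
    using complete_uniform[where S="UNIV :: 'a set"] by (force simp: filterlim_def)
  then show ?thesis by (auto simp: has_sum_def)
qed

lemma conjugation_has_sum:
  assumes "((\<lambda>e. \<xi> e *\<^sub>C e) has_sum x) E"
  shows "((\<lambda>e. cnj (\<xi> e) *\<^sub>C e) has_sum conjugation E x) E"
proof -
  obtain y where y: "((\<lambda>e. cnj (\<xi> e) *\<^sub>C e) has_sum y) E"
    using conjugated_sum_exists[OF assms] by blast
  have "conjugation E x = y"
    unfolding conjugation_def
  proof (rule the_equality)
    show "\<exists>\<xi>. ((\<lambda>e. \<xi> e *\<^sub>C e) has_sum x) E \<and> ((\<lambda>e. cnj (\<xi> e) *\<^sub>C e) has_sum y) E"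
      using assms y by blast
  next
    fix z assume "\<exists>\<xi>. ((\<lambda>e. \<xi> e *\<^sub>C e) has_sum x) E \<and> ((\<lambda>e. cnj (\<xi> e) *\<^sub>C e) has_sum z) E"
    then obtain \<eta> where \<eta>: "((\<lambda>e. \<eta> e *\<^sub>C e) has_sum x) E" "((\<lambda>e. cnj (\<eta> e) *\<^sub>C e) has_sum z) E"
      by blast
    have "((\<lambda>e. cnj (\<eta> e) *\<^sub>C e) has_sum z) E \<longleftrightarrow> ((\<lambda>e. cnj (\<xi> e) *\<^sub>C e) has_sum z) E"
      using orthogonal_basis_coefficient_unique[OF \<eta>(1) assms] by (intro has_sum_cong) simp
    then show "z = y" using \<eta>(2) y has_sum_unique by blast
  qed
  with y show ?thesis by simp
qed

lemma conjugation_add: "conjugation E (x + y) = conjugation E x + conjugation E y"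
proof -
  obtain \<xi> \<eta> where \<xi>: "((\<lambda>e. \<xi> e *\<^sub>C e) has_sum x) E" and \<eta>: "((\<lambda>e. \<eta> e *\<^sub>C e) has_sum y) E"
    using orthogonal_basisD(3) by meson
  have "((\<lambda>e. (\<xi> e + \<eta> e) *\<^sub>C e) has_sum (x + y)) E"
    using has_sum_add[OF \<xi> \<eta>] by (simp add: scaleC_add_left)
  from conjugation_has_sum[OF this]
  show ?thesis
    using has_sum_add[OF conjugation_has_sum[OF \<xi>] conjugation_has_sum[OF \<eta>]]
    by (simp add: scaleC_add_left has_sum_unique)
qed

lemma conjugation_scaleC: "conjugation E (c *\<^sub>C x) = cnj c *\<^sub>C conjugation E x"
proof -
  obtain \<xi> where \<xi>: "((\<lambda>e. \<xi> e *\<^sub>C e) has_sum x) E"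
    using orthogonal_basisD(3) by meson
  have "((\<lambda>e. (c * \<xi> e) *\<^sub>C e) has_sum (c *\<^sub>C x)) E"
    using has_sum_bounded_linear[OF bounded_linear_scaleC \<xi>, of c] by (simp add: scaleC_scaleC)
  from conjugation_has_sum[OF this]
  show ?thesis
    using has_sum_bounded_linear[OF bounded_linear_scaleC conjugation_has_sum[OF \<xi>], of "cnj c"]
    by (simp add: scaleC_scaleC has_sum_unique)
qed

lemma conjugation_conjugation: "conjugation E (conjugation E x) = x"
proof -
  obtain \<xi> where \<xi>: "((\<lambda>e. \<xi> e *\<^sub>C e) has_sum x) E"
    using orthogonal_basisD(3) by meson
  from conjugation_has_sum[OF conjugation_has_sum[OF this]] show ?thesis
    using \<xi> by (simp add: has_sum_unique)
qed

lemma norm_conjugation: "norm (conjugation E x) = norm x"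
proof -
  obtain \<xi> where \<xi>: "((\<lambda>e. \<xi> e *\<^sub>C e) has_sum x) E"
    using orthogonal_basisD(3) by meson
  have "((\<lambda>F. norm (\<Sum>e\<in>F. \<xi> e *\<^sub>C e)) \<longlongrightarrow> norm x) (finite_subsets_at_top E)"
    using \<xi> unfolding has_sum_def by (rule tendsto_norm)
  moreover have "((\<lambda>F. norm (\<Sum>e\<in>F. cnj (\<xi> e) *\<^sub>C e)) \<longlongrightarrow> norm (conjugation E x)) (finite_subsets_at_top E)"
    using conjugation_has_sum[OF \<xi>] unfolding has_sum_def by (rule tendsto_norm)
  moreover have "eventually (\<lambda>F. norm (\<Sum>e\<in>F. cnj (\<xi> e) *\<^sub>C e) = norm (\<Sum>e\<in>F. \<xi> e *\<^sub>C e))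
      (finite_subsets_at_top E)"
    using dist_conjugated_sums[of _ "{}" \<xi>]
    by (intro eventually_finite_subsets_at_top_weakI) (simp add: dist_norm)
  ultimately have "((\<lambda>F. norm (\<Sum>e\<in>F. \<xi> e *\<^sub>C e)) \<longlongrightarrow> norm (conjugation E x)) (finite_subsets_at_top E)"
    using tendsto_cong by fast
  with \<open>((\<lambda>F. norm (\<Sum>e\<in>F. \<xi> e *\<^sub>C e)) \<longlongrightarrow> norm x) _\<close> show ?thesis
    using tendsto_unique finite_subsets_at_top_neq_bot by blast
qed

lemma cinner_conjugation: "cinner (conjugation E x) (conjugation E y) = cnj (cinner x y)"
proof -
  have Re: "Re (cinner (conjugation E x) (conjugation E y)) = Re (cinner x y)" for x y
    by (rule Re_cinner_eq_if_norm_eq[of "conjugation E" "\<lambda>x. x"])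
      (simp_all add: conjugation_add norm_conjugation)
  show ?thesis
    using Re[of x y] Re[of x "\<i> *\<^sub>C y"]
    by (intro complex_eqI) (simp_all add: conjugation_scaleC cinner_simps)
qed

lemma conjugated_op_in_bounded_ops:
  assumes A: "A \<in> bounded_ops"
  shows "conjugation E \<circ> A \<circ> conjugation E \<in> bounded_ops"
proof -
  obtain K where "\<And>x. norm (A x) \<le> norm x * K"
    using bounded_linear.bounded[OF bounded_opsD(1)[OF A]] by blast
  from this[of "conjugation E _"] show ?thesis
    by (intro bounded_opsI[of _ K])
      (simp_all add: conjugation_add conjugation_scaleC norm_conjugation bounded_opsD[OF A])
qed

lemma cadjoint_conjugated_op:
  assumes A: "A \<in> bounded_ops"
  shows "cadjoint (conjugation E \<circ> A \<circ> conjugation E) = conjugation E \<circ> cadjoint A \<circ> conjugation E"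
proof (rule cadjoint_eqI)
  fix x y
  have "cinner ((conjugation E \<circ> A \<circ> conjugation E) x) y = cnj (cinner (A (conjugation E x)) (conjugation E y))"
    using cinner_conjugation[of "A (conjugation E x)" "conjugation E y"]
    by (simp add: conjugation_conjugation)
  also have "\<dots> = cinner x ((conjugation E \<circ> cadjoint A \<circ> conjugation E) y)"
    using cinner_conjugation[of "conjugation E x" "cadjoint A (conjugation E y)"]
    by (simp add: conjugation_conjugation cinner_cadjoint_right[OF A])
  finally show "cinner ((conjugation E \<circ> A \<circ> conjugation E) x) y
    = cinner x ((conjugation E \<circ> cadjoint A \<circ> conjugation E) y)" .
qed

end

section \<open>Operators with equal moduli\<close>

lemma subspace_range:
  assumes "A \<in> bounded_ops" shows "complex_vector.subspace (range (A :: 'a::chilbert_space \<Rightarrow> 'a))"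
proof -
  have "0 = A 0" "A x + A y = A (x + y)" "c *\<^sub>C A x = A (c *\<^sub>C x)" for x y c
    using assms by (simp_all add: bounded_opsD)
  then show ?thesis unfolding complex_vector.subspace_def by (auto intro: rangeI)
qed

lemma subspace_closure:
  assumes "complex_vector.subspace (S :: 'a::chilbert_space set)"
  shows "complex_vector.subspace (closure S)"
  unfolding complex_vector.subspace_def
proof (intro conjI ballI allI)
  show "0 \<in> closure S"
    using assms complex_vector.subspace_0 closure_subset by blast
next
  fix x y assume "x \<in> closure S" "y \<in> closure S"
  then obtain f g where "\<And>n. f n \<in> S" "f \<longlonglongrightarrow> x" "\<And>n. g n \<in> S" "g \<longlonglongrightarrow> y"
    by (auto simp: closure_sequential)
  then have "(\<forall>n. f n + g n \<in> S) \<and> (\<lambda>n. f n + g n) \<longlonglongrightarrow> x + y"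
    using assms complex_vector.subspace_add by (blast intro: tendsto_add)
  then show "x + y \<in> closure S"
    unfolding closure_sequential by (intro exI[of _ "\<lambda>n. f n + g n"])
next
  fix c x assume "x \<in> closure S"
  then obtain f where "\<And>n. f n \<in> S" "f \<longlonglongrightarrow> x"
    by (auto simp: closure_sequential)
  then have "(\<forall>n. c *\<^sub>C f n \<in> S) \<and> (\<lambda>n. c *\<^sub>C f n) \<longlonglongrightarrow> c *\<^sub>C x"
    using assms complex_vector.subspace_scale bounded_linear.tendsto[OF bounded_linear_scaleC] by blast
  then show "c *\<^sub>C x \<in> closure S"
    unfolding closure_sequential by (intro exI[of _ "\<lambda>n. c *\<^sub>C f n"])
qed

text \<open>
  The kernel of \<open>A\<close> is the orthogonal complement of the range of \<open>A\<^sup>*\<close>, and the double complement of a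
  subspace is its closure.
\<close>

lemma orth_complement_kernel_eq:
  assumes A: "A \<in> bounded_ops"
  shows "orth_complement (kernel A) = closure (range (cadjoint (A :: 'a::chilbert_space \<Rightarrow> 'a)))"
proof
  have A': "cadjoint A \<in> bounded_ops" by (rule cadjoint_in_bounded_ops[OF A])
  have "range (cadjoint A) \<subseteq> orth_complement (kernel A)"
    by (auto simp: orth_complement_def kernel_def cinner_cadjoint_left[OF A])
  then show sub: "closure (range (cadjoint A)) \<subseteq> orth_complement (kernel A)"
    by (rule closure_minimal[OF _ closed_orth_complement])
  show "orth_complement (kernel A) \<subseteq> closure (range (cadjoint A))"
  proof
    fix z assume z: "z \<in> orth_complement (kernel A)"
    obtain p where p: "p \<in> closure (range (cadjoint A))"
        "z - p \<in> orth_complement (closure (range (cadjoint A)))"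
      using projection_exists[OF subspace_closure[OF subspace_range[OF A']] closed_closure] by blast
    have "cinner (A (z - p)) y = 0" for y
    proof -
      have "cadjoint A y \<in> closure (range (cadjoint A))" by (rule subsetD[OF closure_subset rangeI])
      with p(2) have "cinner (z - p) (cadjoint A y) = 0" by (simp add: orth_complement_def)
      then show ?thesis by (simp add: cinner_cadjoint_right[OF A])
    qed
    then have "z - p \<in> kernel A" using cinner_self_eq_0 by (auto simp: kernel_def simp del: cinner_self_eq_0)
    moreover have "z - p \<in> orth_complement (kernel A)"
      using z p(1) sub subspace_orth_complement complex_vector.subspace_diff by blast
    ultimately have "cinner (z - p) (z - p) = 0" by (simp add: orth_complement_def)
    then show "z \<in> closure (range (cadjoint A))" using p(1) by simp
  qed
qed

lemma cinner_orth_projection: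
  assumes "complex_vector.subspace (M::'a::chilbert_space set)" "closed M" "y \<in> M"
  shows "cinner (orth_projection M x) y = cinner x y"
proof -
  have "cinner (x - orth_projection M x) y = 0"
    using orth_projection(2)[OF assms(1,2)] assms(3) by (simp add: orth_complement_def)
  then show ?thesis by (simp add: cinner_simps)
qed

lemma orth_projection_in_bounded_ops:
  assumes M: "complex_vector.subspace (M::'a::chilbert_space set)" "closed M"
  shows "orth_projection M \<in> bounded_ops"
proof (rule bounded_opsI[of _ 1])
  note P = orth_projection(1)[OF M]
  show "orth_projection M (x + y) = orth_projection M x + orth_projection M y" for x y
    using orth_projection[OF M, of x] orth_projection[OF M, of y]
    by (intro orth_projection_eqI[OF M(1)])
      (auto simp: orth_complement_def cinner_simps complex_vector.subspace_add[OF M(1)])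
  show "orth_projection M (c *\<^sub>C x) = c *\<^sub>C orth_projection M x" for c x
    using orth_projection[OF M, of x]
    by (intro orth_projection_eqI[OF M(1)])
      (auto simp: orth_complement_def cinner_simps complex_vector.subspace_scale[OF M(1)])
  show "norm (orth_projection M x) \<le> norm x * 1" for x
  proof (cases "orth_projection M x = 0")
    case False
    have "(norm (orth_projection M x))\<^sup>2 = cmod (cinner (orth_projection M x) (orth_projection M x))"
      by (simp add: cinner_self norm_power)
    also have "\<dots> = cmod (cinner x (orth_projection M x))"
      by (simp only: cinner_orth_projection[OF M P])
    also have "\<dots> \<le> norm x * norm (orth_projection M x)" by (rule cmod_cinner_le)
    finally show ?thesis using False by (simp add: power2_eq_square)
  qed simp
qed

text \<open>
  If \<open>B\<close> and \<open>D\<close> have the same norms on every vector then \<open>B y \<mapsto> D y\<close> is a well defined isometry of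
  the range of \<open>B\<close>.  It extends by continuity to the closure of that range, and by \<open>0\<close> to the
  orthogonal complement.
\<close>

theorem isometry_between_ranges:
  fixes B D :: "'a::chilbert_space \<Rightarrow> 'a"
  assumes B: "B \<in> bounded_ops" and D: "D \<in> bounded_ops" and norm_eq: "\<And>y. norm (B y) = norm (D y)"
  shows "\<exists>V\<in>bounded_ops. (\<forall>y. V (B y) = D y) \<and>
    (\<forall>z. norm (V z) = norm (orth_projection (closure (range B)) z))"
proof -
  let ?L = "closure (range B)"
  define f where "f = D \<circ> inv B"
  have dist_eq: "dist (D x) (D y) = dist (B x) (B y)" for x y
    using norm_eq[of "x - y"] by (simp add: dist_norm bounded_opsD[OF B] bounded_opsD[OF D])
  have f: "f (B y) = D y" for y
    using dist_eq[of "inv B (B y)" y] by (simp add: f_def f_inv_into_f)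
  have "uniformly_continuous_on (range B) f"
    unfolding uniformly_continuous_on_def by (auto simp: f dist_eq)
  then obtain g where g: "uniformly_continuous_on ?L g" "\<And>u. u \<in> range B \<Longrightarrow> f u = g u"
    by (rule uniformly_continuous_on_extension_on_closure) blast
  have gB: "g (B y) = D y" for y using f g(2) by (metis rangeI)
  have approx: "\<exists>y. (\<lambda>n. B (y n)) \<longlonglongrightarrow> u" if "u \<in> ?L" for u
  proof -
    from that obtain s where "\<forall>n. s n \<in> range B" and s: "s \<longlonglongrightarrow> u"
      unfolding closure_sequential by blast
    then have "\<forall>n. \<exists>y. s n = B y" by blast
    then obtain y where "\<forall>n. s n = B (y n)" by metis
    then have "s = (\<lambda>n. B (y n))" by blast
    with s show ?thesis by blast
  qed
  have lim: "(\<lambda>n. D (y n)) \<longlonglongrightarrow> g u" if "(\<lambda>n. B (y n)) \<longlonglongrightarrow> u" "u \<in> ?L" for y u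
  proof -
    have "continuous_on ?L g" using g(1) by (rule uniformly_continuous_imp_continuous)
    then have "(\<lambda>n. g (B (y n))) \<longlonglongrightarrow> g u"
      using that by (rule continuous_on_tendsto_compose)
        (intro always_eventually allI subsetD[OF closure_subset rangeI])
    then show ?thesis by (simp add: gB)
  qed
  have L: "complex_vector.subspace ?L" by (rule subspace_closure[OF subspace_range[OF B]])
  have g_add: "g (u + v) = g u + g v" if uv: "u \<in> ?L" "v \<in> ?L" for u v
  proof -
    obtain x y where x: "(\<lambda>n. B (x n)) \<longlonglongrightarrow> u" and y: "(\<lambda>n. B (y n)) \<longlonglongrightarrow> v"
      using approx uv by metis
    have "(\<lambda>n. D (x n + y n)) \<longlonglongrightarrow> g (u + v)"
      using tendsto_add[OF x y] uv
      by (intro lim) (simp_all add: bounded_opsD(2)[OF B] complex_vector.subspace_add[OF L])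
    moreover have "(\<lambda>n. D (x n + y n)) \<longlonglongrightarrow> g u + g v"
      using tendsto_add[OF lim[OF x uv(1)] lim[OF y uv(2)]] by (simp add: bounded_opsD(2)[OF D])
    ultimately show ?thesis by (rule LIMSEQ_unique)
  qed
  have g_scale: "g (c *\<^sub>C u) = c *\<^sub>C g u" if u: "u \<in> ?L" for c u
  proof -
    obtain x where x: "(\<lambda>n. B (x n)) \<longlonglongrightarrow> u"
      using approx u by metis
    have "(\<lambda>n. D (c *\<^sub>C x n)) \<longlonglongrightarrow> g (c *\<^sub>C u)"
      using bounded_linear.tendsto[OF bounded_linear_scaleC x] u
      by (intro lim) (simp_all add: bounded_opsD(5)[OF B] complex_vector.subspace_scale[OF L])
    moreover have "(\<lambda>n. D (c *\<^sub>C x n)) \<longlonglongrightarrow> c *\<^sub>C g u"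
      using bounded_linear.tendsto[OF bounded_linear_scaleC lim[OF x u]]
      by (simp add: bounded_opsD(5)[OF D])
    ultimately show ?thesis by (rule LIMSEQ_unique)
  qed
  have g_norm: "norm (g u) = norm u" if u: "u \<in> ?L" for u
  proof -
    obtain x where x: "(\<lambda>n. B (x n)) \<longlonglongrightarrow> u"
      using approx u by metis
    show ?thesis
      using tendsto_norm[OF x] tendsto_norm[OF lim[OF x u]] LIMSEQ_unique by (simp add: norm_eq) blast
  qed
  define P where "P = orth_projection ?L"
  have PL: "P z \<in> ?L" for z unfolding P_def by (rule orth_projection(1)[OF L closed_closure])
  have P: "P \<in> bounded_ops" unfolding P_def by (rule orth_projection_in_bounded_ops[OF L closed_closure])
  obtain K where "\<And>z. norm (P z) \<le> norm z * K"
    using bounded_linear.bounded[OF bounded_opsD(1)[OF P]] by blast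
  then have "g \<circ> P \<in> bounded_ops"
    by (intro bounded_opsI[of _ K]) (simp_all add: bounded_opsD[OF P] g_add g_scale g_norm PL)
  moreover have "(g \<circ> P) (B y) = D y" for y
  proof -
    have "B y \<in> ?L" by (rule subsetD[OF closure_subset rangeI])
    then have "P (B y) = B y"
      unfolding P_def by (intro orth_projection_eqI[OF L]) (simp_all add: orth_complement_def)
    then show ?thesis by (simp add: gB)
  qed
  moreover have "norm ((g \<circ> P) z) = norm (P z)" for z by (simp add: g_norm PL)
  ultimately show ?thesis unfolding P_def by blast
qed

text \<open>
  Here \<open>\<parallel>C\<^sup>* U y\<parallel> = \<parallel>A\<^sup>* y\<parallel>\<close> for all \<open>y\<close> says that \<open>C C\<^sup>* = U A A\<^sup>* U\<^sup>*\<close>.  The partial isometry extends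
  the map \<open>A\<^sup>* y \<mapsto> C\<^sup>* U y\<close>.
\<close>

theorem partial_isometry_factorization:
  fixes A C U :: "'a::chilbert_space \<Rightarrow> 'a"
  assumes A: "A \<in> bounded_ops" and C: "C \<in> bounded_ops" and U: "unitary U"
    and norm_eq: "\<And>y. norm (cadjoint C (U y)) = norm (cadjoint A y)"
  shows "\<exists>V. partial_isometry V \<and> cadjoint V \<circ> V = right_support A \<and> C = U \<circ> A \<circ> cadjoint V"
proof -
  define M where "M = orth_complement (kernel A)"
  have M_eq: "M = closure (range (cadjoint A))" unfolding M_def by (rule orth_complement_kernel_eq[OF A])
  have M: "complex_vector.subspace M" "closed M"
    unfolding M_def by (rule subspace_orth_complement closed_orth_complement)+
  define P where "P = orth_projection M"
  have P: "P \<in> bounded_ops" unfolding P_def by (rule orth_projection_in_bounded_ops[OF M])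
  have PM: "P z \<in> M" "z - P z \<in> orth_complement M" for z
    unfolding P_def by (rule orth_projection[OF M])+
  have "cadjoint C \<circ> U \<in> bounded_ops"
    by (intro bounded_ops_comp cadjoint_in_bounded_ops C unitaryD(1)[OF U])
  then obtain V where V: "V \<in> bounded_ops" "\<And>y. V (cadjoint A y) = cadjoint C (U y)"
      "\<And>z. norm (V z) = norm (P z)"
    using isometry_between_ranges[OF cadjoint_in_bounded_ops[OF A], of "cadjoint C \<circ> U"] norm_eq
    unfolding P_def M_eq by auto
  have kerV: "P z = 0 \<Longrightarrow> z \<in> kernel V" for z using V(3)[of z] by (simp add: kernel_def)
  have "partial_isometry V"
    unfolding partial_isometry_def
  proof (intro conjI ballI V(1))
    fix x assume x: "x \<in> orth_complement (kernel V)"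
    have "P (P x) = P x"
      unfolding P_def using PM(1)[of x, unfolded P_def]
      by (intro orth_projection_eqI[OF M(1)]) (simp_all add: orth_complement_def)
    then have "x - P x \<in> kernel V" by (intro kerV) (simp add: bounded_opsD[OF P])
    with x have "cinner x (x - P x) = 0" by (simp add: orth_complement_def)
    moreover have "cinner (x - P x) (P x) = 0" using PM by (auto simp: orth_complement_def)
    ultimately have "cinner (x - P x) (x - P x) = 0"
      using cinner_eq_0_commute[of "P x" "x - P x"] by (simp add: cinner_diff(1)[of x "P x" "x - P x"])
    then show "norm (V x) = norm x" using V(3)[of x] by simp
  qed
  moreover have "cadjoint V \<circ> V = right_support A"
  proof
    fix y
    have "cinner x (cadjoint V (V y)) = cinner x (P y)" for x
    proof -
      have "cinner x (cadjoint V (V y)) = cinner (P x) (P y)"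
        by (simp add: cinner_cadjoint_right[OF V(1)] cinner_eq_if_norm_eq[OF V(1) P V(3)])
      also have "\<dots> = cinner x (P y)"
        using PM(1) unfolding P_def by (intro cinner_orth_projection[OF M])
      finally show ?thesis .
    qed
    then show "(cadjoint V \<circ> V) y = right_support A y"
      by (simp add: right_support_def P_def M_def cinner_eqI)
  qed
  moreover have "C = U \<circ> A \<circ> cadjoint V"
  proof
    fix x
    have "cinner y (C x) = cinner y (U (A (cadjoint V x)))" for y
    proof -
      define w where "w = cadjoint U y"
      have y: "y = U w" by (simp add: w_def unitaryD(3)[OF U])
      have "cinner y (C x) = cinner (V (cadjoint A w)) x"
        by (simp add: V(2) y cinner_cadjoint_left[OF C])
      also have "\<dots> = cinner w (A (cadjoint V x))"
        by (simp add: cinner_cadjoint_right[OF V(1), symmetric] cinner_cadjoint_left[OF A])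
      finally show ?thesis by (simp add: y unitaryD(4)[OF U])
    qed
    then show "C x = (U \<circ> A \<circ> cadjoint V) x" by (simp add: cinner_eqI)
  qed
  ultimately show ?thesis by blast
qed

section \<open>Wigner's theorem\<close>

lemma norm_diff_real_combination_sq:
  fixes u v w :: "'a::chilbert_space" and a b :: real
  shows "(norm (u - (complex_of_real a *\<^sub>C v + complex_of_real b *\<^sub>C w)))\<^sup>2 =
    (norm u)\<^sup>2 + a\<^sup>2 * (norm v)\<^sup>2 + b\<^sup>2 * (norm w)\<^sup>2 + 2 * a * b * Re (cinner v w)
      - 2 * a * Re (cinner u v) - 2 * b * Re (cinner u w)"
  by (simp add: norm_diff_sq norm_add_sq cinner_simps power_mult_distrib algebra_simps)

text \<open>
  The length of a real combination is determined by the real parts of the inner products of its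
  terms, so a map preserving these parts takes vanishing real combinations to vanishing ones.
\<close>

lemma real_linear_if_Re_cinner_preserved:
  fixes R :: "'a::chilbert_space \<Rightarrow> 'b::chilbert_space" and a b :: real
  assumes Re: "\<And>x y. x \<in> M \<Longrightarrow> y \<in> M \<Longrightarrow> Re (cinner (R x) (R y)) = Re (cinner x y)"
    and M: "x \<in> M" "y \<in> M" "complex_of_real a *\<^sub>C x + complex_of_real b *\<^sub>C y \<in> M"
  shows "R (complex_of_real a *\<^sub>C x + complex_of_real b *\<^sub>C y) = complex_of_real a *\<^sub>C R x + complex_of_real b *\<^sub>C R y"
proof -
  let ?z = "complex_of_real a *\<^sub>C x + complex_of_real b *\<^sub>C y"
  have norm: "(norm (R x))\<^sup>2 = (norm x)\<^sup>2" if "x \<in> M" for x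
    using Re[OF that that] by (simp add: Re_cinner_self)
  have "(norm (R ?z - (complex_of_real a *\<^sub>C R x + complex_of_real b *\<^sub>C R y)))\<^sup>2
    = (norm (?z - (complex_of_real a *\<^sub>C x + complex_of_real b *\<^sub>C y)))\<^sup>2"
    unfolding norm_diff_real_combination_sq by (simp add: norm Re M)
  then show ?thesis by simp
qed

lemma cmod_one_add_sq: "(cmod (1 + z))\<^sup>2 = 1 + 2 * Re z + (cmod z)\<^sup>2"
  by (simp add: cmod_power2 power2_sum)

text \<open>
  Fix a unit vector \<open>e\<close>.  For \<open>x\<close> orthogonal to \<open>e\<close> the phase of \<open>T (e + x)\<close> can be chosen so that its
  component along \<open>T e\<close> is \<open>T e\<close> itself; let \<open>R x\<close> be the rest, so that \<open>R x\<close> is \<open>T x\<close> up to a phase.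
  Transition probabilities between the vectors \<open>x\<close> give \<open>\<bar>\<langle>R x, R y\<rangle>\<bar> = \<bar>\<langle>x, y\<rangle>\<bar>\<close>, those between the
  vectors \<open>e + x\<close> give \<open>\<bar>1 + \<langle>R x, R y\<rangle>\<bar> = \<bar>1 + \<langle>x, y\<rangle>\<bar>\<close>, and together they determine
  \<open>Re \<langle>R x, R y\<rangle>\<close>.  Hence \<open>R\<close> is real linear.  Since \<open>R (\<i>x)\<close> is a multiple of \<open>R x\<close> with purely
  imaginary factor of modulus one, \<open>R (\<i>x) = \<plusminus>\<i> R x\<close>, and additivity makes the sign independent of \<open>x\<close>.
  So \<open>R\<close> is linear or conjugate linear, and so is its extension that sends \<open>e\<close> to \<open>T e\<close>.
\<close>

theorem Wigner:
  fixes T :: "'a::chilbert_space \<Rightarrow> 'a"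
  assumes pres: "\<And>x y. cmod (cinner (T x) (T y)) = cmod (cinner x y)"
  shows "\<exists>S \<kappa>. (\<kappa> = (\<lambda>c. c) \<or> \<kappa> = cnj) \<and>
    (\<forall>x y. S (x + y) = S x + S y) \<and> (\<forall>c x. S (c *\<^sub>C x) = \<kappa> c *\<^sub>C S x) \<and>
    (\<forall>x. norm (S x) = norm x) \<and> (\<forall>x. \<exists>c. cmod c = 1 \<and> T x = c *\<^sub>C S x)"
proof (cases "\<forall>x::'a. x = 0")
  case True
  then have "T x = 1 *\<^sub>C x" for x by metis
  then show ?thesis
    by (intro exI[of _ "\<lambda>x::'a. x"] exI[of _ "\<lambda>c::complex. c"]) (auto intro!: exI[of _ 1])
next
  case False
  then obtain x0 :: 'a where "x0 \<noteq> 0" by blast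
  define e where "e = inverse (norm x0) *\<^sub>R x0"
  have norm_e: "norm e = 1" using \<open>x0 \<noteq> 0\<close> by (simp add: e_def)
  then have ee: "cinner e e = 1" by (simp add: cinner_self)
  have norm_T: "norm (T x) = norm x" for x
    using pres[of x x] by (simp add: cinner_self norm_power power2_eq_iff_nonneg)
  define e' where "e' = T e"
  have ee': "cinner e' e' = 1" using norm_e norm_T by (simp add: e'_def cinner_self)
  define M where "M = {x. cinner x e = 0}"
  have M_add: "x + y \<in> M" if "x \<in> M" "y \<in> M" for x y using that by (simp add: M_def cinner_simps)
  have M_scale: "c *\<^sub>C x \<in> M" if "x \<in> M" for c x using that by (simp add: M_def cinner_simps)
  have M_e: "cinner x e = 0" "cinner e x = 0" if "x \<in> M" for x
    using that cinner_eq_0_commute[of x e] by (simp_all add: M_def)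

  define a where "a = (\<lambda>x. cnj (cinner (T (e + x)) e'))"
  define R where "R = (\<lambda>x. a x *\<^sub>C T (e + x) - e')"
  have a1: "cmod (a x) = 1" if "x \<in> M" for x
    using pres[of "e + x" e] M_e[OF that] ee by (simp add: a_def e'_def cinner_simps)
  have e'R: "e' + R x = a x *\<^sub>C T (e + x)" for x by (simp add: R_def)
  have R_e': "cinner (R x) e' = 0" "cinner e' (R x) = 0" if "x \<in> M" for x
  proof -
    have "a x * cinner (T (e + x)) e' = 1"
      using a1[OF that] complex_norm_square[of "a x"] by (simp add: a_def mult.commute)
    then show "cinner (R x) e' = 0" by (simp add: R_def cinner_simps ee')
    then show "cinner e' (R x) = 0" using cinner_eq_0_commute by blast
  qed
  have cmod_e'R: "cmod (cinner z' (e' + R x)) = cmod (cinner z' (T (e + x)))" if "x \<in> M" for z' x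
    using a1[OF that] by (simp add: e'R cinner_simps norm_mult del: cinner_add_right)
  have one_add: "cmod (1 + cinner (R x) (R y)) = cmod (1 + cinner x y)" if "x \<in> M" "y \<in> M" for x y
  proof -
    have "cmod (1 + cinner (R x) (R y)) = cmod (cinner (e' + R x) (e' + R y))"
      using that by (simp add: cinner_simps R_e' ee')
    also have "\<dots> = cmod (cinner (e + x) (e + y))"
      by (metis cmod_e'R cmod_cinner_commute pres that)
    also have "\<dots> = cmod (1 + cinner x y)" using that by (simp add: cinner_simps M_e ee)
    finally show ?thesis .
  qed
  have norm_R: "norm (R x) = norm x" if "x \<in> M" for x
  proof -
    have "cmod (complex_of_real (1 + (norm (R x))\<^sup>2)) = cmod (complex_of_real (1 + (norm x)\<^sup>2))"
      using one_add[OF that that] by (simp add: cinner_self)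
    then have "(norm (R x))\<^sup>2 = (norm x)\<^sup>2" by (simp only: norm_of_real) simp
    then show ?thesis by (simp add: power2_eq_iff_nonneg)
  qed
  have T_R: "\<exists>c. cmod c = 1 \<and> T x = c *\<^sub>C R x" if "x \<in> M" for x
  proof (rule phase_if_cmod_cinner_eq)
    have "cmod (cinner (T x) e') = 0" using pres[of x e] M_e[OF that] by (simp add: e'_def)
    then have "cmod (cinner (T x) (R x)) = cmod (cinner (T x) (e' + R x))" by (simp add: cinner_simps)
    also have "\<dots> = cmod (cinner x (e + x))" using that by (simp add: cmod_e'R pres)
    also have "\<dots> = (norm (T x))\<^sup>2"
      using that by (simp add: cinner_simps M_e cinner_self norm_power norm_T)
    finally show "cmod (cinner (T x) (R x)) = (norm (T x))\<^sup>2" .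
  qed (use that in \<open>simp add: norm_T norm_R\<close>)
  have cmod_R: "cmod (cinner (R x) (R y)) = cmod (cinner x y)" if xy: "x \<in> M" "y \<in> M" for x y
  proof -
    obtain c d where "cmod c = 1" "T x = c *\<^sub>C R x" "cmod d = 1" "T y = d *\<^sub>C R y"
      using T_R xy by meson
    then show ?thesis using pres[of x y] by (simp add: cinner_simps norm_mult)
  qed
  have Re_R: "Re (cinner (R x) (R y)) = Re (cinner x y)" if "x \<in> M" "y \<in> M" for x y
    using cmod_one_add_sq[of "cinner (R x) (R y)"] cmod_one_add_sq[of "cinner x y"]
    by (simp add: one_add cmod_R that)
  have R_lin: "R (complex_of_real s *\<^sub>C x + complex_of_real t *\<^sub>C y)
      = complex_of_real s *\<^sub>C R x + complex_of_real t *\<^sub>C R y"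
    if "x \<in> M" "y \<in> M" for x y s t
    using that by (intro real_linear_if_Re_cinner_preserved[of M] Re_R) (auto intro: M_add M_scale)
  have R_add: "R (x + y) = R x + R y" if "x \<in> M" "y \<in> M" for x y
    using R_lin[OF that, of 1 1] by simp

  have R_i: "R (\<i> *\<^sub>C x) = \<i> *\<^sub>C R x \<or> R (\<i> *\<^sub>C x) = - \<i> *\<^sub>C R x" if x: "x \<in> M" for x
  proof (cases "x = 0")
    case True
    then show ?thesis using norm_R[OF x] by simp
  next
    case False
    have "\<exists>c. cmod c = 1 \<and> R (\<i> *\<^sub>C x) = c *\<^sub>C R x"
      using x by (intro phase_if_cmod_cinner_eq)
        (simp_all add: norm_R M_scale cmod_R cinner_simps norm_mult cinner_self norm_power)
    then obtain c where c: "cmod c = 1" "R (\<i> *\<^sub>C x) = c *\<^sub>C R x" by blast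
    have "Re c * (norm x)\<^sup>2 = 0"
      using Re_R[OF M_scale[OF x, of \<i>] x] x by (simp add: c(2) cinner_simps cinner_self norm_R Re_power2)
    then have "Re c = 0" using False by simp
    then have "c = \<i> \<or> c = - \<i>" using c(1) by (auto simp: complex_eq_iff cmod_def)
    then show ?thesis using c(2) by auto
  qed
  have "(\<forall>x\<in>M. R (\<i> *\<^sub>C x) = \<i> *\<^sub>C R x) \<or> (\<forall>x\<in>M. R (\<i> *\<^sub>C x) = - \<i> *\<^sub>C R x)"
  proof (rule ccontr)
    assume "\<not> ?thesis"
    then obtain x y where x: "x \<in> M" "R (\<i> *\<^sub>C x) \<noteq> \<i> *\<^sub>C R x" and y: "y \<in> M" "R (\<i> *\<^sub>C y) \<noteq> - \<i> *\<^sub>C R y"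
      by blast
    have Rx: "R (\<i> *\<^sub>C x) = - (\<i> *\<^sub>C R x)" and Ry: "R (\<i> *\<^sub>C y) = \<i> *\<^sub>C R y"
      using R_i x y by auto
    have "R (\<i> *\<^sub>C (x + y)) = - (\<i> *\<^sub>C R x) + \<i> *\<^sub>C R y"
      using x y by (simp add: scaleC_add_right R_add M_scale Rx Ry)
    moreover have "R (\<i> *\<^sub>C (x + y)) = \<i> *\<^sub>C R x + \<i> *\<^sub>C R y \<or> R (\<i> *\<^sub>C (x + y)) = - (\<i> *\<^sub>C R x) + - (\<i> *\<^sub>C R y)"
      using R_i[OF M_add[OF x(1) y(1)]] x(1) y(1) by (auto simp: R_add scaleC_add_right)
    ultimately have "- (\<i> *\<^sub>C R x) = \<i> *\<^sub>C R x \<or> \<i> *\<^sub>C R y = - (\<i> *\<^sub>C R y)" by auto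
    then show False using x y Rx Ry by auto
  qed
  then obtain \<kappa> where \<kappa>: "\<kappa> = (\<lambda>c. c) \<or> \<kappa> = cnj" and R_ki: "\<And>x. x \<in> M \<Longrightarrow> R (\<i> *\<^sub>C x) = \<kappa> \<i> *\<^sub>C R x"
    by (metis complex_cnj_i)
  have \<kappa>_simps: "\<kappa> (c + d) = \<kappa> c + \<kappa> d" "\<kappa> (c * d) = \<kappa> c * \<kappa> d" "cmod (\<kappa> c) = cmod c"
      "\<kappa> (complex_of_real r) = complex_of_real r" for c d r
    using \<kappa> by auto
  have R_scale: "R (c *\<^sub>C x) = \<kappa> c *\<^sub>C R x" if x: "x \<in> M" for c x
  proof -
    have c: "c = complex_of_real (Re c) + complex_of_real (Im c) * \<i>" by (simp add: complex_eq_iff)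
    have "R (c *\<^sub>C x) = R (complex_of_real (Re c) *\<^sub>C x + complex_of_real (Im c) *\<^sub>C \<i> *\<^sub>C x)"
      by (subst c) (simp add: scaleC_add_left scaleC_scaleC)
    also have "\<dots> = complex_of_real (Re c) *\<^sub>C R x + complex_of_real (Im c) *\<^sub>C \<kappa> \<i> *\<^sub>C R x"
      by (simp only: R_lin[OF x M_scale[OF x]] R_ki[OF x])
    also have "\<dots> = \<kappa> (complex_of_real (Re c) + complex_of_real (Im c) * \<i>) *\<^sub>C R x"
      by (simp only: \<kappa>_simps scaleC_add_left scaleC_scaleC)
    also have "\<dots> = \<kappa> c *\<^sub>C R x" by (simp only: c[symmetric])
    finally show ?thesis .
  qed

  \<comment> \<open>\<open>p\<close> is the projection onto \<open>M\<close>; \<open>S\<close> acts as \<open>R\<close> on \<open>M\<close> and sends \<open>e\<close> to \<open>e'\<close>.\<close>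
  define p where "p = (\<lambda>z. z - cinner z e *\<^sub>C e)"
  have pM: "p z \<in> M" for z by (simp add: M_def p_def cinner_simps ee)
  have p_add: "p (z + w) = p z + p w" for z w by (simp add: p_def cinner_simps scaleC_add_left)
  have p_scale: "p (c *\<^sub>C z) = c *\<^sub>C p z" for c z
    by (simp add: p_def cinner_simps complex_vector.scale_right_diff_distrib scaleC_scaleC)
  define S where "S = (\<lambda>z. \<kappa> (cinner z e) *\<^sub>C e' + R (p z))"
  have S_add: "S (z + w) = S z + S w" for z w
    by (simp add: S_def p_add R_add pM cinner_simps \<kappa>_simps scaleC_add_left)
  have S_scale: "S (c *\<^sub>C z) = \<kappa> c *\<^sub>C S z" for c z
    by (simp add: S_def p_scale R_scale pM cinner_simps \<kappa>_simps scaleC_add_right scaleC_scaleC)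
  have norm_S: "norm (S z) = norm z" for z
  proof -
    have "norm e' = 1" using norm_e norm_T by (simp add: e'_def)
    then have "(norm (S z))\<^sup>2 = (cmod (cinner z e))\<^sup>2 + (norm (p z))\<^sup>2"
      by (simp add: S_def norm_add_sq cinner_simps R_e' pM norm_R \<kappa>_simps)
    also have "\<dots> = (norm (cinner z e *\<^sub>C e + p z))\<^sup>2"
      using M_e[OF pM] by (simp add: norm_add_sq cinner_simps norm_e)
    also have "cinner z e *\<^sub>C e + p z = z" by (simp add: p_def)
    finally show ?thesis by (simp add: power2_eq_iff_nonneg)
  qed
  have T_S: "\<exists>c. cmod c = 1 \<and> T z = c *\<^sub>C S z" for z
  proof (cases "cinner z e = 0")
    case True
    then have "z \<in> M" "S z = R z" using \<kappa> by (auto simp: M_def S_def p_def)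
    with T_R show ?thesis by simp
  next
    case False
    define \<alpha> where "\<alpha> = cinner z e"
    define y where "y = inverse \<alpha> *\<^sub>C p z"
    have yM: "y \<in> M" using pM M_scale by (simp add: y_def)
    have z: "z = \<alpha> *\<^sub>C (e + y)" using False by (simp add: y_def \<alpha>_def p_def scaleC_add_right scaleC_scaleC)
    have "S z = \<kappa> \<alpha> *\<^sub>C S (e + y)" by (subst z) (rule S_scale)
    moreover have "p (e + y) = y" using M_e[OF yM] by (simp add: p_def cinner_simps ee)
    then have "S (e + y) = e' + R y" using M_e[OF yM] \<kappa>_simps(4)[of 1] by (simp add: S_def cinner_simps ee)
    ultimately have "cmod (cinner (T z) (S z)) = cmod \<alpha> * cmod (cinner (T z) (e' + R y))"
      by (simp add: cinner_scaleC_right norm_mult \<kappa>_simps)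
    also have "\<dots> = cmod \<alpha> * cmod (cinner z (e + y))" using yM by (simp add: cmod_e'R pres)
    also have "\<dots> = cmod (cinner z (\<alpha> *\<^sub>C (e + y)))" by (simp add: cinner_scaleC_right norm_mult)
    also have "\<dots> = (norm (T z))\<^sup>2" by (simp add: z[symmetric] cinner_self norm_power norm_T)
    finally show ?thesis by (intro phase_if_cmod_cinner_eq) (simp_all add: norm_T norm_S)
  qed
  show ?thesis using \<kappa> S_add S_scale norm_S T_S by blast
qed

text \<open>
  A conjugate linear isometry becomes linear when composed with the conjugation of a basis.
\<close>

corollary Wigner_unitary:
  fixes T :: "'a::chilbert_space \<Rightarrow> 'a"
  assumes E: "orthogonal_basis E"
    and pres: "\<And>x y. cmod (cinner (T x) (T y)) = cmod (cinner x y)"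
    and onto: "\<And>y. \<exists>x c. cmod c = 1 \<and> T x = c *\<^sub>C y"
  shows "\<exists>U. unitary U \<and> ((\<forall>x. \<exists>c. cmod c = 1 \<and> T x = c *\<^sub>C U x) \<or>
    (\<forall>x. \<exists>c. cmod c = 1 \<and> T x = c *\<^sub>C U (conjugation E x)))"
proof -
  obtain S \<kappa> where \<kappa>: "\<kappa> = (\<lambda>c. c) \<or> \<kappa> = cnj" and add: "\<And>x y. S (x + y) = S x + S y"
    and scale: "\<And>c x. S (c *\<^sub>C x) = \<kappa> c *\<^sub>C S x" and norm: "\<And>x. norm (S x) = norm x"
    and T: "\<And>x. \<exists>c. cmod c = 1 \<and> T x = c *\<^sub>C S x"
    using Wigner[OF pres] by blast
  have surj: "\<exists>x. S x = y" for y
  proof -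
    obtain x c d where c: "cmod c = 1" "T x = c *\<^sub>C y" and d: "T x = d *\<^sub>C S x"
      using onto T by metis
    have "c \<noteq> 0" using c(1) by auto
    then have "y = inverse c *\<^sub>C (c *\<^sub>C y)" by (simp add: scaleC_scaleC)
    also have "\<dots> = (inverse c * d) *\<^sub>C S x" by (simp only: c(2)[symmetric] d scaleC_scaleC)
    also have "\<dots> = S (\<kappa> (inverse c * d) *\<^sub>C x)" using \<kappa> by (auto simp: scale)
    finally show ?thesis by metis
  qed
  show ?thesis
  proof (cases "\<kappa> = (\<lambda>c. c)")
    case True
    have "unitary S"
      using surj by (intro unitaryI bounded_opsI[of _ 1]) (auto simp: add scale norm True surj_def, metis)
    with T show ?thesis by blast
  next
    case False
    with \<kappa> have \<kappa>: "\<kappa> = cnj" by blast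
    let ?J = "conjugation E"
    have JJ: "?J (?J x) = x" for x by (rule conjugation_conjugation[OF E])
    have "unitary (S \<circ> ?J)"
    proof (rule unitaryI)
      show "S \<circ> ?J \<in> bounded_ops"
        by (rule bounded_opsI[of _ 1])
          (simp_all add: add scale norm \<kappa> conjugation_add[OF E] conjugation_scaleC[OF E] norm_conjugation[OF E])
      show "surj (S \<circ> ?J)"
        unfolding surj_def using surj JJ by (metis comp_apply)
    qed (simp add: norm norm_conjugation[OF E])
    moreover have "\<forall>x. \<exists>c. cmod c = 1 \<and> T x = c *\<^sub>C (S \<circ> ?J) (?J x)" using T by (simp add: JJ)
    ultimately show ?thesis by blast
  qed
qed

section \<open>Orthogonality of ranges\<close>

text \<open>\<open>A\<^sup>* B = 0\<close>, expressed without the adjoint.\<close>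

definition orth_ranges :: "('a::chilbert_space \<Rightarrow> 'a) \<Rightarrow> ('a \<Rightarrow> 'a) \<Rightarrow> bool" where
  "orth_ranges A B \<longleftrightarrow> (\<forall>x y. cinner (A x) (B y) = 0)"

lemma orth_ranges_iff:
  assumes "A \<in> bounded_ops"
  shows "orth_ranges A B \<longleftrightarrow> cadjoint A \<circ> B = (\<lambda>x::'a::chilbert_space. 0)"
proof
  assume orth: "orth_ranges A B"
  show "cadjoint A \<circ> B = (\<lambda>x. 0)"
  proof
    fix x show "(cadjoint A \<circ> B) x = 0"
      using orth by (intro cinner_eqI) (simp add: cinner_cadjoint_right[OF assms] orth_ranges_def)
  qed
next
  assume "cadjoint A \<circ> B = (\<lambda>x. 0)"
  then have "cadjoint A (B y) = 0" for y by (metis comp_apply)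
  then show "orth_ranges A B"
    using cinner_cadjoint_right[OF assms] by (metis orth_ranges_def cinner_zero(2))
qed

lemma orth_ranges_self: "orth_ranges A A \<longleftrightarrow> (\<forall>x. A x = (0::'a::chilbert_space))"
  unfolding orth_ranges_def by (metis cinner_self_eq_0 cinner_zero(1))

lemma norm_eq_0_iff_orth_ranges:
  assumes "unitarily_invariant_norm N" "A \<in> bounded_ops" "B \<in> bounded_ops"
  shows "N (cadjoint A \<circ> B) = 0 \<longleftrightarrow> orth_ranges A (B :: 'a::chilbert_space \<Rightarrow> 'a)"
  using assms
  by (simp add: orth_ranges_iff unitarily_invariant_normD(2) bounded_ops_comp cadjoint_in_bounded_ops)

lemma orth_ranges_rank_one_right:
  "orth_ranges A (rank_one x y) \<longleftrightarrow> y = 0 \<or> (\<forall>z. cinner (A z) (x::'a::chilbert_space) = 0)"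
proof -
  have "orth_ranges A (rank_one x y) \<longleftrightarrow> (\<forall>z w. cinner w y = 0 \<or> cinner (A z) x = 0)"
    by (auto simp: orth_ranges_def rank_one_def cinner_simps)
  also have "\<dots> \<longleftrightarrow> y = 0 \<or> (\<forall>z. cinner (A z) x = 0)"
    using cinner_self_eq_0[of y] by fastforce
  finally show ?thesis .
qed

text \<open>
  If \<open>d \<noteq> 0\<close> were the component of \<open>B w\<close> orthogonal to \<open>x\<close>, then the operator \<open>rank_one d d\<close> would be
  orthogonal to \<open>rank_one x x'\<close> but not to \<open>B\<close>.
\<close>

lemma in_line_if_orth_ranges:
  assumes S: "rank_one_ops \<subseteq> \<S>"
    and sub: "\<And>C. C \<in> \<S> \<Longrightarrow> orth_ranges (rank_one x x') C \<Longrightarrow> orth_ranges B C"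
    and x: "(x::'a::chilbert_space) \<noteq> 0"
  shows "\<exists>k. B w = k *\<^sub>C x"
proof -
  define k where "k = cinner (B w) x / complex_of_real ((norm x)\<^sup>2)"
  define d where "d = B w - k *\<^sub>C x"
  have dx: "cinner d x = 0" using x by (simp add: d_def k_def cinner_simps cinner_self)
  then have xd: "cinner x d = 0" using cinner_eq_0_commute by blast
  have "d = 0"
  proof (rule ccontr)
    assume "d \<noteq> 0"
    then have "rank_one d d \<in> \<S>" using S rank_one_ops_iff by blast
    moreover have "orth_ranges (rank_one x x') (rank_one d d)"
      unfolding orth_ranges_rank_one_right
      by (simp add: rank_one_def cinner_simps xd)
    ultimately have "orth_ranges B (rank_one d d)" by (rule sub)
    then have "cinner (B w) d = 0" using \<open>d \<noteq> 0\<close> by (simp add: orth_ranges_rank_one_right)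
    moreover have "B w = d + k *\<^sub>C x" by (simp add: d_def)
    ultimately have "cinner d d = 0" using xd by (simp add: cinner_simps)
    then show False using \<open>d \<noteq> 0\<close> by simp
  qed
  then show ?thesis by (auto simp: d_def)
qed

text \<open>
  An operator is orthogonal to \<open>A\<close> if and only if its range lies in the orthogonal complement of the
  range of \<open>A\<close>.  For \<open>A \<noteq> 0\<close> this complement is as large as possible exactly when the range of \<open>A\<close> is a
  line, and \<open>\<S>\<close> contains enough operators to tell different complements apart.  As \<open>A \<noteq> 0\<close> means that
  \<open>A\<close> is not orthogonal to itself, the criterion mentions nothing but orthogonality, and so it is
  transported by every surjection that preserves orthogonality in both directions.
\<close>

lemma rank_one_iff_orth_ranges:
  assumes S: "rank_one_ops \<subseteq> \<S>" "\<S> \<subseteq> bounded_ops" and A: "A \<in> \<S>"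
  shows "A \<in> rank_one_ops \<longleftrightarrow> \<not> orth_ranges A A \<and>
    (\<forall>B\<in>\<S>. \<not> orth_ranges B B \<longrightarrow> (\<forall>C\<in>\<S>. orth_ranges A C \<longrightarrow> orth_ranges B C) \<longrightarrow>
      (\<forall>C\<in>\<S>. orth_ranges B C \<longrightarrow> orth_ranges A (C :: 'a::chilbert_space \<Rightarrow> 'a)))"
    (is "_ \<longleftrightarrow> _ \<and> ?maximal")
proof
  assume "A \<in> rank_one_ops"
  then obtain x y where xy: "x \<noteq> 0" "y \<noteq> 0" and A_eq: "A = rank_one x y" unfolding rank_one_ops_iff by blast
  have "A y \<noteq> 0" using xy by (simp add: A_eq rank_one_def)
  then have "\<not> orth_ranges A A" unfolding orth_ranges_self by blast
  moreover have ?maximal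
  proof (intro ballI impI)
    fix B C assume B: "\<not> orth_ranges B B" and sub: "\<forall>C\<in>\<S>. orth_ranges A C \<longrightarrow> orth_ranges B C"
      and C: "C \<in> \<S>" "orth_ranges B C"
    obtain w where w: "B w \<noteq> 0" using B by (auto simp: orth_ranges_self)
    obtain k where k: "B w = k *\<^sub>C x"
      using in_line_if_orth_ranges[OF S(1), of x y B w] sub xy(1) by (auto simp: A_eq)
    have "k * cinner x (C v) = 0" for v
    proof -
      have "cinner (B w) (C v) = 0" using C(2) by (simp add: orth_ranges_def)
      then show ?thesis by (simp add: k cinner_scaleC_left)
    qed
    moreover have "k \<noteq> 0" using w k by auto
    ultimately show "orth_ranges A C" by (simp add: orth_ranges_def A_eq rank_one_def cinner_simps)
  qed
  ultimately show "\<not> orth_ranges A A \<and> ?maximal" by blast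
next
  assume max: "\<not> orth_ranges A A \<and> ?maximal"
  then obtain z where z: "A z \<noteq> 0" by (auto simp: orth_ranges_self)
  define x where "x = A z"
  have x: "x \<noteq> 0" using z by (simp add: x_def)
  have B: "rank_one x x \<in> \<S>" using S(1) x rank_one_ops_iff by blast
  have "rank_one x x x \<noteq> 0" using x by (simp add: rank_one_def)
  then have "\<not> orth_ranges (rank_one x x) (rank_one x x)" unfolding orth_ranges_self by blast
  moreover have "\<forall>C\<in>\<S>. orth_ranges A C \<longrightarrow> orth_ranges (rank_one x x) C"
    by (auto simp: orth_ranges_def rank_one_def cinner_simps x_def)
  ultimately have sub: "orth_ranges (rank_one x x) C \<Longrightarrow> orth_ranges A C" if "C \<in> \<S>" for C
    using max B that by blast
  have A': "A \<in> bounded_ops" using A S(2) by blast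
  obtain y where A_eq: "A = rank_one x y"
    using rank_one_if_values_in_line[OF A' x] in_line_if_orth_ranges[OF S(1) sub x] by blast
  moreover have "y \<noteq> 0" using z by (auto simp: A_eq rank_one_def)
  ultimately show "A \<in> rank_one_ops" unfolding rank_one_ops_iff using x by blast
qed

section \<open>Maps preserving the norms of the products\<close>

text \<open>
  The norm of \<open>A\<^sup>* (rank_one x y)\<close> is a constant times \<open>\<parallel>A\<^sup>* x\<parallel> \<parallel>y\<parallel>\<close>.  If \<open>\<Phi>\<close> maps \<open>rank_one x y\<close> to
  \<open>rank_one a b\<close> this yields \<open>\<parallel>\<Phi>(A)\<^sup>* a\<parallel> \<parallel>b\<parallel> = \<parallel>A\<^sup>* x\<parallel> \<parallel>y\<parallel>\<close>, from which everything follows: taking \<open>A\<close>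
  of rank one as well compares inner products, and taking \<open>A = rank_one x y\<close> gives
  \<open>\<parallel>a\<parallel> \<parallel>b\<parallel> = \<parallel>x\<parallel> \<parallel>y\<parallel>\<close>.  The vector \<open>T x\<close> is a positive multiple of the first factor of the image of
  \<open>rank_one x x\<close>.
\<close>

lemma induced_vector_map:
  fixes \<Phi> :: "('a::chilbert_space \<Rightarrow> 'a) \<Rightarrow> ('a \<Rightarrow> 'a)"
  assumes A: "\<A> \<subseteq> bounded_ops" "rank_one_ops \<subseteq> \<A>" and B: "\<B> \<subseteq> bounded_ops" "rank_one_ops \<subseteq> \<B>"
    and N: "unitarily_invariant_norm N" and onto: "\<Phi> ` \<A> = \<B>"
    and pres: "\<And>A B. A \<in> \<A> \<Longrightarrow> B \<in> \<A> \<Longrightarrow> N (cadjoint (\<Phi> A) \<circ> \<Phi> B) = N (cadjoint A \<circ> B)"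
  shows "\<exists>T. (\<forall>x y. cmod (cinner (T x) (T y)) = cmod (cinner x y)) \<and>
    (\<forall>y. \<exists>x c. cmod c = 1 \<and> T x = c *\<^sub>C y) \<and>
    (\<forall>A\<in>\<A>. \<forall>x. norm (cadjoint (\<Phi> A) (T x)) = norm (cadjoint A x))"
proof -
  obtain c where c: "c > 0" and N_rank_one: "\<And>x y. N (rank_one x y) = c * norm x * norm y"
    using unitarily_invariant_norm_rank_one[OF N] by blast
  have bdd: "A \<in> bounded_ops" "\<Phi> A \<in> bounded_ops" "\<Phi> A \<in> \<B>" if "A \<in> \<A>" for A
    using that A(1) B(1) onto by blast+
  have orth: "orth_ranges (\<Phi> A) (\<Phi> B) \<longleftrightarrow> orth_ranges A B" if "A \<in> \<A>" "B \<in> \<A>" for A B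
    using that by (simp add: norm_eq_0_iff_orth_ranges[OF N, symmetric] bdd pres)
  have rank_one_iff: "\<Phi> A \<in> rank_one_ops \<longleftrightarrow> A \<in> rank_one_ops" if "A \<in> \<A>" for A
  proof -
    have "\<Phi> A \<in> \<Phi> ` \<A>" using that by blast
    then have "\<Phi> A \<in> rank_one_ops \<longleftrightarrow> \<not> orth_ranges (\<Phi> A) (\<Phi> A) \<and>
      (\<forall>B\<in>\<A>. \<not> orth_ranges (\<Phi> B) (\<Phi> B) \<longrightarrow>
        (\<forall>C\<in>\<A>. orth_ranges (\<Phi> A) (\<Phi> C) \<longrightarrow> orth_ranges (\<Phi> B) (\<Phi> C)) \<longrightarrow>
        (\<forall>C\<in>\<A>. orth_ranges (\<Phi> B) (\<Phi> C) \<longrightarrow> orth_ranges (\<Phi> A) (\<Phi> C)))"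
      using rank_one_iff_orth_ranges[OF B(2,1)[folded onto], of "\<Phi> A"] by simp
    also have "\<dots> \<longleftrightarrow> \<not> orth_ranges A A \<and>
      (\<forall>B\<in>\<A>. \<not> orth_ranges B B \<longrightarrow> (\<forall>C\<in>\<A>. orth_ranges A C \<longrightarrow> orth_ranges B C) \<longrightarrow>
        (\<forall>C\<in>\<A>. orth_ranges B C \<longrightarrow> orth_ranges A C))"
      using that by (simp add: orth)
    also have "\<dots> \<longleftrightarrow> A \<in> rank_one_ops"
      using rank_one_iff_orth_ranges[OF A(2,1) that] by simp
    finally show ?thesis .
  qed
  have in_A: "rank_one x y \<in> \<A>" if "x \<noteq> 0" "y \<noteq> 0" for x y
    using that A(2) rank_one_ops_iff by blast
  have adj: "norm (cadjoint (\<Phi> A) a) * norm b = norm (cadjoint A x) * norm y"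
    if "A \<in> \<A>" "rank_one x y \<in> \<A>" "\<Phi> (rank_one x y) = rank_one a b" for A a b x y
  proof -
    have "N (cadjoint (\<Phi> A) \<circ> rank_one a b) = N (cadjoint A \<circ> rank_one x y)"
      using pres[OF that(1,2)] by (simp add: that(3))
    then show ?thesis
      using c that(1) by (simp add: cadjoint_comp_rank_one bdd N_rank_one mult.assoc)
  qed
  have inner: "cmod (cinner a a') * norm b * norm b' = cmod (cinner x x') * norm y * norm y'"
    if "rank_one x y \<in> \<A>" "\<Phi> (rank_one x y) = rank_one a b"
      "rank_one x' y' \<in> \<A>" "\<Phi> (rank_one x' y') = rank_one a' b'" for a b x y a' b' x' y'
    using adj[OF that(3,1,2)] unfolding that(4) cadjoint_rank_one
    by (simp add: rank_one_def ac_simps)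
  have norm_prod: "norm a * norm b = norm x * norm y"
    if "rank_one x y \<in> \<A>" "\<Phi> (rank_one x y) = rank_one a b" for a b x y
  proof -
    have "(norm a * norm b)\<^sup>2 = (norm x * norm y)\<^sup>2"
      using inner[OF that that] by (simp add: cinner_self norm_power power_mult_distrib power2_eq_square norm_mult ac_simps)
    then show ?thesis by (simp add: power2_eq_iff_nonneg)
  qed

  have "\<exists>a b. a \<noteq> 0 \<and> b \<noteq> 0 \<and> \<Phi> (rank_one x x) = rank_one a b" if "x \<noteq> 0" for x
  proof -
    have "rank_one x x \<in> rank_one_ops" using that rank_one_ops_iff by blast
    with rank_one_iff[OF in_A[OF that that]] show ?thesis unfolding rank_one_ops_iff by blast
  qed
  then obtain a b where ab: "\<And>x. x \<noteq> 0 \<Longrightarrow> a x \<noteq> 0 \<and> b x \<noteq> 0 \<and> \<Phi> (rank_one x x) = rank_one (a x) (b x)"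
    by metis
  \<comment> \<open>As \<open>\<parallel>a x\<parallel> \<parallel>b x\<parallel> = \<parallel>x\<parallel>\<^sup>2\<close>, this factor rescales \<open>a x\<close> to the length of \<open>x\<close>.\<close>
  define r where "r = (\<lambda>x. norm (b x) / norm x)"
  define T where "T = (\<lambda>x. if x = 0 then 0 else complex_of_real (r x) *\<^sub>C a x)"
  have T_pres: "cmod (cinner (T x) (T y)) = cmod (cinner x y)" for x y
  proof (cases "x = 0 \<or> y = 0")
    case False
    then have xy: "x \<noteq> 0" "y \<noteq> 0" by simp_all
    have "cmod (cinner (a x) (a y)) * norm (b x) * norm (b y) = cmod (cinner x y) * norm x * norm y"
      using ab xy by (intro inner in_A) simp_all
    then show ?thesis
      using xy by (simp add: T_def cinner_simps norm_mult norm_divide r_def field_simps)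
  qed (auto simp: T_def)
  have T_norm: "norm (T x) = norm x" for x
    using T_pres[of x x] by (simp add: cinner_self norm_power power2_eq_iff_nonneg)
  have T_onto: "\<exists>x d. cmod d = 1 \<and> T x = d *\<^sub>C y" for y
  proof (cases "y = 0")
    case True
    then show ?thesis by (intro exI[of _ 0] exI[of _ 1]) (simp add: T_def)
  next
    case False
    then have y1: "rank_one y y \<in> rank_one_ops" using rank_one_ops_iff by blast
    then obtain A where A1: "A \<in> \<A>" "\<Phi> A = rank_one y y" using B(2) onto by (metis imageE subsetD)
    then have "A \<in> rank_one_ops" using rank_one_iff[OF A1(1)] y1 unfolding A1(2) by blast
    then obtain x z where xz: "x \<noteq> 0" "z \<noteq> 0" "A = rank_one x z" unfolding rank_one_ops_iff by blast
    \<comment> \<open>Since \<open>\<Phi>\<close> maps \<open>rank_one x z\<close> to \<open>rank_one y y\<close>, the vector \<open>T x\<close> must lie on the line of \<open>y\<close>;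
      \<open>u\<close> is the multiple of \<open>x\<close> that has the length of \<open>y\<close>.\<close>
    define k where "k = norm y / norm x"
    define u where "u = complex_of_real k *\<^sub>C x"
    have k: "0 < k" using xz False by (simp add: k_def)
    have u: "u \<noteq> 0" "norm u = norm y" using xz False k by (simp_all add: u_def k_def norm_divide)
    have yxz: "norm y * norm y = norm x * norm z"
      using A1 xz by (intro norm_prod) simp_all
    have "cmod (cinner (a u) y) * norm (b u) * norm y = cmod (cinner u x) * norm u * norm z"
      using ab[OF u(1)] A1 xz by (intro inner in_A u(1)) simp_all
    also have "cmod (cinner u x) = norm y * norm x"
      using xz k by (simp add: u_def cinner_simps norm_mult cinner_self norm_power k_def power2_eq_square norm_divide)
    also have "norm y * norm x * norm u * norm z = (norm y * norm y) * (norm x * norm z)" by (simp add: u(2))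
    also have "\<dots> = ((norm y)\<^sup>2 * norm y) * norm y" by (simp add: yxz[symmetric] power2_eq_square)
    finally have "cmod (cinner (a u) y) * norm (b u) = (norm y)\<^sup>2 * norm y" using False by simp
    moreover have "cmod (cinner (T u) y) = norm (b u) / norm u * cmod (cinner (a u) y)"
      using u(1) by (simp add: T_def cinner_simps norm_mult r_def norm_divide)
    ultimately have "cmod (cinner (T u) y) = (norm (T u))\<^sup>2"
      using False by (simp add: T_norm u(2) field_simps)
    then have "\<exists>d. cmod d = 1 \<and> T u = d *\<^sub>C y" by (intro phase_if_cmod_cinner_eq) (simp_all add: T_norm u(2))
    then show ?thesis by blast
  qed
  have "norm (cadjoint (\<Phi> A) (T x)) = norm (cadjoint A x)" if A1: "A \<in> \<A>" for A x
  proof (cases "x = 0")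
    case True
    then show ?thesis
      using bdd[OF A1] by (simp add: T_def bounded_opsD(4)[OF cadjoint_in_bounded_ops])
  next
    case False
    have "norm (cadjoint (\<Phi> A) (a x)) * norm (b x) = norm (cadjoint A x) * norm x"
      using ab False by (intro adj A1 in_A) simp_all
    then show ?thesis
      using False bdd(2)[OF A1]
      by (simp add: T_def bounded_opsD(5)[OF cadjoint_in_bounded_ops] r_def norm_divide field_simps)
  qed
  with T_pres T_onto show ?thesis by blast
qed

theorem corollary3p2:
  fixes E :: "'a::chilbert_space set"
    and \<A> \<B> :: "('a \<Rightarrow> 'a) set"
    and N :: "('a \<Rightarrow> 'a) \<Rightarrow> real"
    and \<Phi> :: "('a \<Rightarrow> 'a) \<Rightarrow> ('a \<Rightarrow> 'a)"
  defines "J \<equiv> conjugation E"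
  assumes "hilbert_dim_ge TYPE('a) 3"
    and "orthogonal_basis E"
    and "\<A> \<subseteq> bounded_ops" and "rank_one_ops \<subseteq> \<A>"
    and "\<B> \<subseteq> bounded_ops" and "rank_one_ops \<subseteq> \<B>"
    and "unitarily_invariant_norm N"
    and "\<Phi> ` \<A> = \<B>"
    and "\<And>A B. A \<in> \<A> \<Longrightarrow> B \<in> \<A> \<Longrightarrow> N (cadjoint (\<Phi> A) \<circ> \<Phi> B) = N (cadjoint A \<circ> B)"
  shows "\<exists>U V. unitary U \<and> (\<forall>A\<in>\<A>. partial_isometry (V A)) \<and>
    ((\<forall>A\<in>\<A>. cadjoint (V A) \<circ> V A = right_support A \<and>
              \<Phi> A = U \<circ> A \<circ> cadjoint (V A)) \<or>
     (\<forall>A\<in>\<A>. cadjoint (V A) \<circ> V A = right_support (J \<circ> A \<circ> J) \<and>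
              \<Phi> A = U \<circ> (J \<circ> A \<circ> J) \<circ> cadjoint (V A)))"
proof -
  note E = \<open>orthogonal_basis E\<close>
  have bdd: "A \<in> bounded_ops" "\<Phi> A \<in> bounded_ops" if "A \<in> \<A>" for A
    using that assms(4,6,9) by blast+
  obtain T where T_pres: "\<And>x y. cmod (cinner (T x) (T y)) = cmod (cinner x y)"
    and T_onto: "\<And>y. \<exists>x c. cmod c = 1 \<and> T x = c *\<^sub>C y"
    and T: "\<And>A x. A \<in> \<A> \<Longrightarrow> norm (cadjoint (\<Phi> A) (T x)) = norm (cadjoint A x)"
    using induced_vector_map[OF assms(4-10)] by blast
  obtain U where U: "unitary U"
    and T_U: "(\<forall>x. \<exists>c. cmod c = 1 \<and> T x = c *\<^sub>C U x) \<or> (\<forall>x. \<exists>c. cmod c = 1 \<and> T x = c *\<^sub>C U (J x))"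
    using Wigner_unitary[OF E T_pres T_onto] unfolding J_def by blast
  have phase: "norm (cadjoint (\<Phi> A) y) = norm (cadjoint A x)"
    if A: "A \<in> \<A>" and x: "\<exists>c. cmod c = 1 \<and> T x = c *\<^sub>C y" for A x y
  proof -
    obtain c where "cmod c = 1" "T x = c *\<^sub>C y" using x by blast
    then show ?thesis
      using T[OF A, of x] by (simp add: bounded_opsD(5)[OF cadjoint_in_bounded_ops[OF bdd(2)[OF A]]])
  qed
  from T_U show ?thesis
  proof
    assume lin: "\<forall>x. \<exists>c. cmod c = 1 \<and> T x = c *\<^sub>C U x"
    have "\<exists>V. partial_isometry V \<and> cadjoint V \<circ> V = right_support A \<and> \<Phi> A = U \<circ> A \<circ> cadjoint V"
      if "A \<in> \<A>" for A
      using lin that by (intro partial_isometry_factorization bdd U phase) blast+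
    then obtain V where "\<And>A. A \<in> \<A> \<Longrightarrow> partial_isometry (V A) \<and>
        cadjoint (V A) \<circ> V A = right_support A \<and> \<Phi> A = U \<circ> A \<circ> cadjoint (V A)"
      by metis
    with U show ?thesis by blast
  next
    assume conj: "\<forall>x. \<exists>c. cmod c = 1 \<and> T x = c *\<^sub>C U (J x)"
    have JJ: "J (J x) = x" for x unfolding J_def by (rule conjugation_conjugation[OF E])
    have "\<exists>V. partial_isometry V \<and> cadjoint V \<circ> V = right_support (J \<circ> A \<circ> J) \<and>
        \<Phi> A = U \<circ> (J \<circ> A \<circ> J) \<circ> cadjoint V" if A: "A \<in> \<A>" for A
    proof (intro partial_isometry_factorization bdd(2)[OF A] U)
      show "J \<circ> A \<circ> J \<in> bounded_ops"
        unfolding J_def by (rule conjugated_op_in_bounded_ops[OF E bdd(1)[OF A]])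
      fix y
      have "norm (cadjoint (\<Phi> A) (U (J (J y)))) = norm (cadjoint A (J y))"
        using conj by (intro phase A) blast
      then show "norm (cadjoint (\<Phi> A) (U y)) = norm (cadjoint (J \<circ> A \<circ> J) y)"
        by (simp add: JJ) (simp add: J_def cadjoint_conjugated_op[OF E bdd(1)[OF A]] norm_conjugation[OF E])
    qed
    then obtain V where "\<And>A. A \<in> \<A> \<Longrightarrow> partial_isometry (V A) \<and>
        cadjoint (V A) \<circ> V A = right_support (J \<circ> A \<circ> J) \<and> \<Phi> A = U \<circ> (J \<circ> A \<circ> J) \<circ> cadjoint (V A)"
      by metis
    with U show ?thesis by blast
  qed
qed

end
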